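(* Let $X$ and $Y$ be Hilbert spaces, $\Omega\subset X$ be a closed and convex set, and $S_i:X\rightrightarrows Y$, $i=1,2$, with $(\bar x,\bar y)\in\operatorname{gph}(S_1+S_2)|_\Omega$. Define $G:X\times Y\rightrightarrows Y\times Y$ by $$G(x,y):=\{(y_1,y_2)\in Y\times Y: y_1\in S_1(x),\ y_2\in S_2(x),\ y_1+y_2=y\},$$ fix $(\bar y_1,\bar y_2)\in G(\bar x,\bar y)$, and assume that $G$ is inner semicontinuous relative to $\Omega\times Y$ at $(\bar x,\bar y,\bar y_1,\bar y_2)$. Assume also that $\operatorname{gph}S_1|_\Omega$ and $\operatorname{gph}S_2|_\Omega$ are closed around $(\bar x,\bar y_1)$ and $(\bar x,\bar y_2)$, respectively, that either $S_1$ is PSNC relative to $\Omega$ at $(\bar x,\bar y_1)$ or $S_2$ is PSNC relative to $\Omega$ at $(\bar x,\bar y_2)$, and that the qualification condition $$D_M^*(S_1)_\Omega(\bar x|\bar y_1)(0)\cap\big(-D_M^*(S_2)_\Omega(\bar x|\bar y_2)(0)\big)=\{0\}$$ holds. Then for all $y^*\in Y$ we have $$D_M^*(S_1+S_2)_\Omega(\bar x|\bar y)(y^* )\subset D_M^*(S_1)_\Omega(\bar x|\bar y_1)(y^* )+D_M^*(S_2)_\Omega(\bar x|\bar y_2)(y^* ),$$ $$D_N^*(S_1+S_2)_\Omega(\bar x|\bar y)(y^* )\subset D_N^*(S_1)_\Omega(\bar x|\bar y_1)(y^* )+D_N^*(S_2)_\Omega(\bar x|\bar y_2)(y^* ).$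$
   Context: Hilbert spaces are identified with their duals; $\rightharpoonup$ is weak convergence; $X\times Y$ carries the norm $\sqrt{\|x\|^2+\|y\|^2}$. $\operatorname{gph}S=\{(x,y):y\in S(x)\}$; $S|_\Omega(x)=S(x)$ if $x\in\Omega$ and $\emptyset$ otherwise; $(S_1+S_2)(x)=S_1(x)+S_2(x)$ (Minkowski sum). A set is closed around one of its points $\bar u$ if its intersection with some closed set containing $\bar u$ in its interior is closed. Contingent cone at $\bar x\in\Omega$: $T(\bar x;\Omega)=\{z: \exists\, t_k\downarrow0,\ z_k\to z,\ \bar x+t_kz_k\in\Omega\}$. $\varepsilon$-normals at $\bar x\in\Omega$: $\widehat N_\varepsilon(\bar x;\Omega)=\{x^*: \limsup_{x\to\bar x,\,x\in\Omega}\langle x^*,x-\bar x\rangle/\|x-\bar x\|\le\varepsilon\}$. Relative contingent coderivatives (here the truncation set in $Y$ is all of $Y$ and, in Hilbert spaces, the duality mapping used in the general definition is the identity). For $S:X\rightrightarrows Y$ and $(\bar x,\bar y)\in\operatorname{gph}S|_\Omega$, consider sequences $\varepsilon_k\downarrow0$, $(x_k,y_k)\to(\bar x,\bar y)$ with $(x_k,y_k)\in\operatorname{gph}S|_\Omega$, and $(x_k^*,y_k^* )\in X\times Y$ with $$(x_k^*,-y_k^* )\in\widehat N_{\varepsilon_k}\big((x_k,y_k);\operatorname{gph}S|_\Omega\big)\cap\big[T(x_k;\Omega)\times Y\big]\quad\text{for all }k.\qquad( * )$$ $\bar x^*\in D_N^*S_\Omega(\bar x|\bar y)(\bar y^* )$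 (normal) iff there are such sequences with $x_k^*\rightharpoonup\bar x^*$, $y_k^*\rightharpoonup\bar y^*$; $\bar x^*\in D_M^*S_\Omega(\bar x|\bar y)(\bar y^* )$ (mixed) iff there are such sequences with $x_k^*\rightharpoonup\bar x^*$ and $y_k^*\to\bar y^*$ in norm. PSNC: $S$ is PSNC relative to $\Omega$ at $(\bar x,\bar y)\in\operatorname{gph}S|_\Omega$ if for all sequences $\varepsilon_k\in(0,1)$, $\varepsilon_k\downarrow0$, $\operatorname{gph}S|_\Omega\ni(x_k,y_k)\to(\bar x,\bar y)$, $(x_k^*,y_k^* )$ satisfying $( * )$ with $x_k^*\rightharpoonup0$, $y_k^*\to0$, one has $\|x_k^*\|\to0$. Inner semicontinuity: $F:U\rightrightarrows V$ is inner semicontinuous relative to $A\subset U$ at $(\bar u,\bar v)\in\operatorname{gph}F|_A$ if for every sequence $u_k\to\bar u$ with $u_k\in A$, $F(u_k)\ne\emptyset$, there are $v_k\in F(u_k)$ converging to $\bar v$. Here $F=G$, $U=X\times Y$, $A=\Omega\times Y$, $V=Y\times Y$. *)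

theory Defs
  imports "HOL-Analysis.Analysis" "HOL-Library.Set_Algebras"
begin

text \<open>
  Real Hilbert spaces are types of sort \<open>{real_inner, complete_space}\<close>, identified with their
  duals through the inner product. The library norm on a product of such types is the Euclidean
  one. A set-valued mapping from \<open>'a\<close> to \<open>'b\<close> is a function \<open>'a \<Rightarrow> 'b set\<close>. Minkowski sums of
  sets are written with the \<open>+\<close> of Set_Algebras; as unary minus on sets is the complement, the
  reflected set is written \<open>uminus ` A\<close>.
\<close>

definition gph :: "('a \<Rightarrow> 'b set) \<Rightarrow> ('a \<times> 'b) set" where
  "gph S = {(x, y). y \<in> S x}"

definition restr :: "('a \<Rightarrow> 'b set) \<Rightarrow> 'a set \<Rightarrow> 'a \<Rightarrow> 'b set" where
  "restr S \<Omega> x = (if x \<in> \<Omega> then S x else {})"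

definition closed_around :: "'a::topological_space set \<Rightarrow> 'a \<Rightarrow> bool" where
  "closed_around C u \<longleftrightarrow> u \<in> C \<and> (\<exists>W. closed W \<and> u \<in> interior W \<and> closed (C \<inter> W))"

definition weakly_converges :: "(nat \<Rightarrow> 'a::real_inner) \<Rightarrow> 'a \<Rightarrow> bool" where
  "weakly_converges x l \<longleftrightarrow> (\<forall>v. (\<lambda>k. x k \<bullet> v) \<longlonglongrightarrow> l \<bullet> v)"

text \<open>
  The convergence \<open>t \<down> 0\<close> is read, as usual in variational analysis, as
  convergence to zero through positive numbers; monotonicity is not required.
\<close>

definition downto_zero :: "(nat \<Rightarrow> real) \<Rightarrow> bool" where
  "downto_zero t \<longleftrightarrow> (\<forall>k. 0 < t k) \<and> t \<longlonglongrightarrow> 0"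

definition contingent_cone :: "'a::real_normed_vector \<Rightarrow> 'a set \<Rightarrow> 'a set" where
  "contingent_cone x \<Omega> =
     {z. \<exists>t w. downto_zero t \<and> w \<longlonglongrightarrow> z \<and> (\<forall>k. x + t k *\<^sub>R w k \<in> \<Omega>)}"

text \<open>
  The filter \<open>at x within \<Omega>\<close> leaves out the point \<open>x\<close>, where the quotient is undefined. The upper
  limit is taken in the extended reals, so it is \<open>-\<infinity>\<close> at isolated points of \<open>\<Omega>\<close>.
\<close>

definition eps_normals :: "real \<Rightarrow> 'a::real_inner \<Rightarrow> 'a set \<Rightarrow> 'a set" where
  "eps_normals \<epsilon> x \<Omega> =
     {xs. Limsup (at x within \<Omega>) (\<lambda>u. ereal (xs \<bullet> (u - x) / norm (u - x))) \<le> ereal \<epsilon>}"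

text \<open>
  The sequences from which the relative contingent coderivatives and the PSNC property are built:
  \<open>xs\<close> and \<open>ys\<close> are the sequences of dual elements. Note the minus sign in front of \<open>ys k\<close>.
\<close>

definition rel_normal_seq ::
  "('a::real_inner \<Rightarrow> 'b::real_inner set) \<Rightarrow> 'a set \<Rightarrow> 'a \<Rightarrow> 'b \<Rightarrow> (nat \<Rightarrow> real) \<Rightarrow>
   (nat \<Rightarrow> 'a) \<Rightarrow> (nat \<Rightarrow> 'b) \<Rightarrow> (nat \<Rightarrow> 'a) \<Rightarrow> (nat \<Rightarrow> 'b) \<Rightarrow> bool" where
  "rel_normal_seq S \<Omega> x0 y0 \<epsilon> x y xs ys \<longleftrightarrow>
     downto_zero \<epsilon> \<and>
     (\<forall>k. (x k, y k) \<in> gph (restr S \<Omega>)) \<and> (\<lambda>k. (x k, y k)) \<longlonglongrightarrow> (x0, y0) \<and>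
     (\<forall>k. (xs k, - ys k) \<in>
        eps_normals (\<epsilon> k) (x k, y k) (gph (restr S \<Omega>)) \<inter> (contingent_cone (x k) \<Omega> \<times> UNIV))"

definition normal_coderivative ::
  "('a::real_inner \<Rightarrow> 'b::real_inner set) \<Rightarrow> 'a set \<Rightarrow> 'a \<Rightarrow> 'b \<Rightarrow> 'b \<Rightarrow> 'a set" where
  "normal_coderivative S \<Omega> x0 y0 ystar =
     {xstar. \<exists>\<epsilon> x y xs ys. rel_normal_seq S \<Omega> x0 y0 \<epsilon> x y xs ys \<and>
        weakly_converges xs xstar \<and> weakly_converges ys ystar}"

definition mixed_coderivative ::
  "('a::real_inner \<Rightarrow> 'b::real_inner set) \<Rightarrow> 'a set \<Rightarrow> 'a \<Rightarrow> 'b \<Rightarrow> 'b \<Rightarrow> 'a set" where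
  "mixed_coderivative S \<Omega> x0 y0 ystar =
     {xstar. \<exists>\<epsilon> x y xs ys. rel_normal_seq S \<Omega> x0 y0 \<epsilon> x y xs ys \<and>
        weakly_converges xs xstar \<and> ys \<longlonglongrightarrow> ystar}"

definition PSNC ::
  "('a::real_inner \<Rightarrow> 'b::real_inner set) \<Rightarrow> 'a set \<Rightarrow> 'a \<Rightarrow> 'b \<Rightarrow> bool" where
  "PSNC S \<Omega> x0 y0 \<longleftrightarrow>
     (\<forall>\<epsilon> x y xs ys.
        (\<forall>k. \<epsilon> k \<in> {0<..<1}) \<and> rel_normal_seq S \<Omega> x0 y0 \<epsilon> x y xs ys \<and>
        weakly_converges xs 0 \<and> ys \<longlonglongrightarrow> 0 \<longrightarrow> (\<lambda>k. norm (xs k)) \<longlonglongrightarrow> 0)"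

definition inner_semicontinuous ::
  "('u::topological_space \<Rightarrow> 'v::topological_space set) \<Rightarrow> 'u set \<Rightarrow> 'u \<Rightarrow> 'v \<Rightarrow> bool" where
  "inner_semicontinuous F A u0 v0 \<longleftrightarrow>
     (\<forall>u. u \<longlonglongrightarrow> u0 \<and> (\<forall>k. u k \<in> A \<and> F (u k) \<noteq> {}) \<longrightarrow>
        (\<exists>v. (\<forall>k. v k \<in> F (u k)) \<and> v \<longlonglongrightarrow> v0))"

definition sum_decomposition ::
  "('a \<Rightarrow> 'b::plus set) \<Rightarrow> ('a \<Rightarrow> 'b set) \<Rightarrow> 'a \<times> 'b \<Rightarrow> ('b \<times> 'b) set" where
  "sum_decomposition S1 S2 = (\<lambda>(x, y). {(y1, y2). y1 \<in> S1 x \<and> y2 \<in> S2 x \<and> y1 + y2 = y})"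

end

theory Submission
  imports Defs "HOL-Library.Diagonal_Subsequence"
begin

text \<open>
  The sum rule rests on a fuzzy version of it at a single point, followed by a passage to the limit.

  Let \<open>(xs, - ys)\<close> be an \<open>\<epsilon>\<close>-normal to the graph of the restricted sum \<open>S1 + S2\<close> at
  \<open>(x, v1 + v2)\<close>, with \<open>v1 \<in> S1 x\<close> and \<open>v2 \<in> S2 x\<close>. Write \<open>A\<close> and \<open>B\<close> for the graphs of
  the restrictions of \<open>S1\<close> and \<open>S2\<close>, and let \<open>\<psi>\<close> be the linear functional \<open>(xs, - ys)\<close> at
  \<open>(p1, u1 + u2)\<close>, centred at \<open>(x, v1 + v2)\<close> and reduced by \<open>2 * \<epsilon>\<close> times the distance.
  By \<open>\<epsilon>\<close>-normality, \<open>\<psi>\<close> is nonpositive near the reference point at pairs of points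
  \<open>(p1, u1)\<close> of \<open>A\<close> and \<open>(p2, u2)\<close> of \<open>B\<close> with \<open>p1 = p2\<close>. Hence, for \<open>\<nu> > 0\<close>, the function
  \<open>\<phi> = norm (p1 - p2, max 0 (\<nu> - \<psi>))\<close> is positive on \<open>A \<times> B\<close> near the reference point, where its
  value is \<open>\<nu>\<close>. Ekeland's principle yields a nearby point of \<open>A \<times> B\<close> that minimizes \<open>\<phi>\<close> up to a
  perturbation of slope \<open>\<epsilon>\<close>. As \<open>\<phi> > 0\<close> there, \<open>\<phi>\<close> has a first-order expansion up to
  \<open>\<epsilon>\<close>-terms, whose coefficients are a unit vector \<open>(e, lam)\<close>, the normalization of
  \<open>(p1 - p2, max 0 (\<nu> - \<psi>))\<close>. Minimality says that \<open>(lam xs - e, - lam ys)\<close> and \<open>(e, - lam ys)\<close>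
  are, up to a multiple of \<open>\<epsilon>\<close>, normals to \<open>A\<close> and \<open>B\<close>. The tangency requirement holds
  because \<open>\<Omega>\<close> is convex: \<open>e\<close> is a positive multiple of \<open>p1 - p2\<close> and so is tangent at
  \<open>p2\<close>, while \<open>- e\<close> is tangent at \<open>p1\<close>; and \<open>xs\<close>, being tangent at \<open>x\<close>, is close to
  a multiple \<open>(q - x) / t\<close> with \<open>q \<in> \<Omega>\<close>, hence to \<open>(q - p1) / t\<close>, which is tangent at \<open>p1\<close>.
  This is \<open>fuzzy_sum_rule\<close>.

  Applied along a sequence that defines an element of the coderivative of the sum, it gives sequences
  \<open>e\<close> and \<open>lam\<close> for which, after passing to a subsequence, \<open>e\<close> converges weakly and \<open>lam\<close>
  converges to some \<open>l\<close>. If \<open>l = 0\<close>, the \<open>ys\<close>-parts vanish in norm since weakly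
  convergent sequences are bounded, so the qualification condition forces the weak limit of \<open>e\<close> to
  be zero and the PSNC property makes \<open>e\<close> converge to zero in norm, against
  \<open>(norm e)\<^sup>2 + lam\<^sup>2 = 1\<close>. If \<open>l > 0\<close>, division by \<open>lam\<close> turns the two normals into
  \<open>(xs - e / lam, - ys)\<close> and \<open>(e / lam, - ys)\<close> up to vanishing errors. The sequence
  \<open>ys\<close> itself is retained, so the same argument serves the mixed and the normal coderivative.
  This is \<open>sum_coderivative_sequences\<close>.
\<close>

section \<open>Weak convergence in Hilbert spaces\<close>

text \<open>
  The uniform boundedness principle for functionals represented by vectors, from the Baire category
  theorem: one of the closed sets of points at which all functionals are bounded by \<open>n\<close> contains a ball.
\<close>

lemma pointwise_bounded_imp_bounded:
  fixes x :: "nat \<Rightarrow> 'a::{real_inner, complete_space}"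
  assumes bdd: "\<And>v. bounded (range (\<lambda>k. x k \<bullet> v))"
  shows "bounded (range x)"
proof -
  define E where "E = (\<lambda>n::nat. {v. \<forall>k. \<bar>x k \<bullet> v\<bar> \<le> real n})"
  have clE: "closed (E n)" for n
    unfolding E_def by (intro closed_Collect_all closed_Collect_le continuous_intros)
  have cover: "\<Union>(range E) = UNIV"
  proof (safe, simp_all)
    fix v
    obtain M where "\<forall>k. \<bar>x k \<bullet> v\<bar> \<le> M"
      using bdd[of v] by (auto simp: bounded_iff)
    then have "v \<in> E (nat \<lceil>M\<rceil>)"
      unfolding E_def by (auto intro: order_trans[OF _ real_nat_ceiling_ge])
    then show "\<exists>n. v \<in> E n" ..
  qed
  have "\<exists>n. interior (E n) \<noteq> {}"
  proof (rule ccontr)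
    assume "\<not> ?thesis"
    moreover have "Met_TC.mcomplete TYPE('a)"
      unfolding Met_TC.mcomplete_def by (auto simp: Cauchy_convergent_iff convergent_def)
    ultimately have "interior (\<Union>(range E)) = {}"
      using Met_TC.metric_Baire_category_alt[of "range E"] clE by auto
    then show False using cover by simp
  qed
  then obtain n a where "a \<in> interior (E n)" by auto
  then obtain r where r: "r > 0" "cball a r \<subseteq> E n"
    using mem_interior_cball by blast
  have "norm (x k) \<le> 2 * real n / r" for k
  proof (cases "x k = 0")
    case False
    define v where "v = a + (r / norm (x k)) *\<^sub>R x k"
    have "v \<in> cball a r" "a \<in> cball a r"
      using r False by (auto simp: v_def dist_norm)
    then have "v \<in> E n" "a \<in> E n" using r by blast+
    then have "\<bar>x k \<bullet> v\<bar> \<le> real n" "\<bar>x k \<bullet> a\<bar> \<le> real n"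
      unfolding E_def by blast+
    moreover have "x k \<bullet> v = x k \<bullet> a + r * norm (x k)"
      using False by (simp add: v_def inner_add_right power2_norm_eq_inner[symmetric] power2_eq_square)
    ultimately have "r * norm (x k) \<le> 2 * real n" by linarith
    then show ?thesis using r by (simp add: field_simps)
  qed (use r in auto)
  then show ?thesis by (auto simp: bounded_iff)
qed

lemma weakly_converges_imp_bounded:
  fixes x :: "nat \<Rightarrow> 'a::{real_inner, complete_space}"
  assumes "weakly_converges x l"
  shows "bounded (range x)"
proof (rule pointwise_bounded_imp_bounded)
  show "bounded (range (\<lambda>k. x k \<bullet> v))" for v
    using assms unfolding weakly_converges_def by (intro convergent_imp_bounded[of _ "l \<bullet> v"]) simp
qed

text \<open>
  The parallelogram law shows that almost norm-minimal points of the sets form a Cauchy sequence.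
\<close>

lemma nested_convex_common_point:
  fixes K :: "nat \<Rightarrow> 'a::{real_inner, complete_space} set"
  assumes conv: "\<And>n. convex (K n)" and dec: "decseq K"
    and bdd: "\<And>n. \<exists>z\<in>K n. norm z \<le> M"
  shows "\<exists>c. \<forall>n. c \<in> closure (K n)"
proof -
  define d where "d = (\<lambda>n. INF z\<in>K n. (norm z)\<^sup>2)"
  have bb: "bdd_below ((\<lambda>z. (norm z)\<^sup>2) ` K n)" for n
    by (intro bdd_belowI2[of _ 0]) auto
  have ne: "K n \<noteq> {}" for n using bdd by blast
  have d_le: "d n \<le> (norm z)\<^sup>2" if "z \<in> K n" for n z
    unfolding d_def using bb that by (rule cINF_lower)
  have "incseq d"
    unfolding incseq_def d_def using dec bb ne
    by (intro allI impI cINF_superset_mono) (auto simp: decseq_def)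
  moreover have "d n \<le> M\<^sup>2" for n
  proof -
    obtain z where "z \<in> K n" "norm z \<le> M" using bdd by blast
    then show ?thesis using d_le[of z n] power_mono[of "norm z" M 2] by simp
  qed
  ultimately obtain D where D: "d \<longlonglongrightarrow> D" "\<And>n. d n \<le> D"
    using incseq_convergent[of d "M\<^sup>2"] by blast
  define h where "h = (\<lambda>n. inverse (real (Suc n)))"
  have h: "0 < h n" for n by (simp add: h_def)
  have "h \<longlonglongrightarrow> 0" unfolding h_def by (rule LIMSEQ_inverse_real_of_nat)
  have "\<exists>z\<in>K n. (norm z)\<^sup>2 < d n + h n" for n
    using cINF_less_iff[OF ne bb, of n "d n + h n"] h by (simp add: d_def)
  then obtain c where c: "\<And>n. c n \<in> K n" "\<And>n. (norm (c n))\<^sup>2 < d n + h n"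
    by metis
  have near: "(dist (c m) (c n))\<^sup>2 \<le> 2 * (D - d n) + 4 * h n" if "n \<le> m" for m n
  proof -
    have "c m \<in> K n" using c(1)[of m] decseqD[OF dec that] by blast
    then have "(1/2) *\<^sub>R c m + (1/2) *\<^sub>R c n \<in> K n"
      using conv c by (intro convexD) auto
    then have "d n \<le> (norm ((1/2) *\<^sub>R c m + (1/2) *\<^sub>R c n))\<^sup>2" by (rule d_le)
    also have "\<dots> = (2 * (norm (c m))\<^sup>2 + 2 * (norm (c n))\<^sup>2 - (norm (c m - c n))\<^sup>2) / 4"
      by (simp add: power2_norm_eq_inner inner_add_left inner_add_right inner_diff_left
          inner_diff_right inner_commute[of "c n" "c m"] add_divide_distrib)
    finally have "(dist (c m) (c n))\<^sup>2 \<le> 2 * (norm (c m))\<^sup>2 + 2 * (norm (c n))\<^sup>2 - 4 * d n"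
      by (simp add: dist_norm)
    moreover have "h m \<le> h n"
      using that by (simp add: h_def le_imp_inverse_le)
    ultimately show ?thesis using c(2)[of n] c(2)[of m] D(2)[of m] by argo
  qed
  have "(\<lambda>n. 2 * (D - d n) + 4 * h n) \<longlonglongrightarrow> 2 * (D - D) + 4 * 0"
    by (intro tendsto_intros D \<open>h \<longlonglongrightarrow> 0\<close>)
  then have lim: "(\<lambda>n. 2 * (D - d n) + 4 * h n) \<longlonglongrightarrow> 0" by simp
  have "Cauchy c"
  proof (rule metric_CauchyI)
    fix e :: real assume e: "0 < e"
    then have "eventually (\<lambda>n. 2 * (D - d n) + 4 * h n < (e/2)\<^sup>2) sequentially"
      by (intro order_tendstoD[OF lim]) auto
    then obtain N where "2 * (D - d N) + 4 * h N < (e/2)\<^sup>2"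
      by (auto simp: eventually_sequentially)
    then have "dist (c m) (c N) < e/2" if "m \<ge> N" for m
      using near[OF that] e by (intro power2_less_imp_less[of "dist (c m) (c N)"]) auto
    then show "\<exists>M. \<forall>m\<ge>M. \<forall>n\<ge>M. dist (c m) (c n) < e"
      by (meson dist_triangle_half_l dist_commute)
  qed
  then obtain l where l: "c \<longlonglongrightarrow> l" by (auto simp: Cauchy_convergent_iff convergent_def)
  have "l \<in> closure (K n)" for n
  proof (rule Lim_in_closed_set[OF closed_closure _ _ l])
    show "\<forall>\<^sub>F m in sequentially. c m \<in> closure (K n)"
      using eventually_ge_at_top[of n]
    proof eventually_elim
      case (elim m)
      then show ?case using c(1)[of m] decseqD[OF dec] closure_subset by blast
    qed
  qed simp
  then show ?thesis by blast
qed

text \<open>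
  By the preceding lemma some point lies in the closed convex hulls of all tails of the sequence.
  Closed slabs therefore force its inner product with \<open>v\<close> to be the limit along the sequence whenever
  that limit exists, so it is the only candidate for a weak limit.
\<close>

lemma bounded_sequence_hull_point:
  fixes e :: "nat \<Rightarrow> 'a::{real_inner, complete_space}"
  assumes "bounded (range e)"
  obtains c where "c \<in> closure (convex hull (range e))"
    and "\<And>v l. (\<lambda>k. e k \<bullet> v) \<longlonglongrightarrow> l \<Longrightarrow> c \<bullet> v = l"
proof -
  obtain M where M: "\<And>k. norm (e k) \<le> M" using assms by (auto simp: bounded_iff)
  define K where "K = (\<lambda>n. convex hull (e ` {n..}))"
  have "decseq K" unfolding K_def decseq_def by (auto intro!: hull_mono)
  moreover have "\<exists>z\<in>K n. norm z \<le> M" for n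
    using M[of n] by (intro bexI[of _ "e n"]) (auto simp: K_def hull_inc)
  ultimately obtain c where c: "\<And>n. c \<in> closure (K n)"
    using nested_convex_common_point[of K M] by (auto simp: K_def)
  have "c \<bullet> v = l" if lim: "(\<lambda>k. e k \<bullet> v) \<longlonglongrightarrow> l" for v l
  proof -
    have "\<bar>c \<bullet> v - l\<bar> \<le> \<eta>" if "\<eta> > 0" for \<eta>
    proof -
      obtain n where n: "\<And>k. k \<ge> n \<Longrightarrow> \<bar>e k \<bullet> v - l\<bar> < \<eta>"
        using LIMSEQ_D[OF lim \<open>\<eta> > 0\<close>] by auto
      let ?H = "{z. v \<bullet> z \<le> l + \<eta>} \<inter> {z. v \<bullet> z \<ge> l - \<eta>}"
      have "e k \<in> ?H" if "k \<ge> n" for k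
        using n[OF that] by (auto simp: inner_commute abs_less_iff)
      then have "K n \<subseteq> ?H"
        unfolding K_def
        by (intro hull_minimal convex_Int convex_halfspace_le convex_halfspace_ge) auto
      moreover have "closed ?H"
        by (intro closed_Int closed_halfspace_le closed_halfspace_ge)
      ultimately have "c \<in> ?H" using c[of n] closure_minimal by blast
      then show ?thesis by (auto simp: inner_commute abs_le_iff)
    qed
    then show ?thesis
      by (metis dense_ge abs_le_zero_iff eq_iff_diff_eq_0)
  qed
  moreover have "K 0 = convex hull (range e)" by (auto simp: K_def atLeast_0)
  ultimately show ?thesis using that c[of 0] by metis
qed

text \<open>
  Weak sequential compactness of bounded sets. A diagonal argument makes the inner products with
  every term of the sequence converge, and a hull point of the resulting subsequence is its weak
  limit. Neither separability nor the Riesz representation theorem enters.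
\<close>

lemma bounded_imp_weakly_convergent_subsequence:
  fixes e :: "nat \<Rightarrow> 'a::{real_inner, complete_space}"
  assumes bdd: "bounded (range e)"
  obtains \<sigma> l where "strict_mono (\<sigma> :: nat \<Rightarrow> nat)" and "weakly_converges (e \<circ> \<sigma>) l"
proof -
  have bdd_inner: "bounded (range (\<lambda>k. e (s k) \<bullet> v))" for s :: "nat \<Rightarrow> nat" and v
  proof -
    have "bounded ((\<lambda>z. z \<bullet> v) ` range e)"
      by (intro bounded_linear_image bdd bounded_linear_inner_left)
    then show ?thesis by (rule bounded_subset) auto
  qed
  interpret D: subseqs "\<lambda>j s. convergent (\<lambda>k. e (s k) \<bullet> e j)"
  proof
    fix j and s :: "nat \<Rightarrow> nat" assume "strict_mono s"
    show "\<exists>r. strict_mono r \<and> convergent (\<lambda>k. e ((s \<circ> r) k) \<bullet> e j)"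
      using bounded_imp_convergent_subsequence[OF bdd_inner[of s "e j"]]
      by (auto simp: convergent_def o_def)
  qed
  define \<sigma> where "\<sigma> = D.diagseq"
  have \<sigma>: "strict_mono \<sigma>" unfolding \<sigma>_def by (rule D.subseq_diagseq)
  have conv: "convergent (\<lambda>k. e (\<sigma> k) \<bullet> e j)" for j
  proof -
    have "convergent (\<lambda>k. e ((D.diagseq \<circ> (+) (Suc j)) k) \<bullet> e j)"
    proof (rule D.diagseq_holds)
      fix r s :: "nat \<Rightarrow> nat" and n
      assume "strict_mono r" "convergent (\<lambda>k. e (s k) \<bullet> e n)"
      then show "convergent (\<lambda>k. e ((s \<circ> r) k) \<bullet> e n)"
        using convergent_subseq_convergent[of "\<lambda>k. e (s k) \<bullet> e n" r] by (simp add: o_def)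
    qed
    then have "convergent (\<lambda>k. e (\<sigma> (k + Suc j)) \<bullet> e j)"
      by (simp add: \<sigma>_def o_def add.commute)
    then show ?thesis by (rule convergent_ignore_initial_segment[THEN iffD1])
  qed
  have sub_bdd: "bounded (range (\<lambda>k. e (s k)))" for s :: "nat \<Rightarrow> nat"
    by (rule bounded_subset[OF bdd]) auto
  obtain c where c: "c \<in> closure (convex hull (range (\<lambda>k. e (\<sigma> k))))"
    "\<And>v l. (\<lambda>k. e (\<sigma> k) \<bullet> v) \<longlonglongrightarrow> l \<Longrightarrow> c \<bullet> v = l"
    using bounded_sequence_hull_point[OF sub_bdd] by metis
  have "(\<lambda>k. e (\<sigma> k) \<bullet> v) \<longlonglongrightarrow> c \<bullet> v" for v
  proof (rule ccontr)
    assume "\<not> ?thesis"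
    then obtain \<eta> where \<eta>: "\<eta> > 0" "\<And>N. \<exists>k\<ge>N. \<bar>e (\<sigma> k) \<bullet> v - c \<bullet> v\<bar> \<ge> \<eta>"
      unfolding LIMSEQ_iff by (auto simp: not_less)
    then have "infinite {k. \<bar>e (\<sigma> k) \<bullet> v - c \<bullet> v\<bar> \<ge> \<eta>}"
      unfolding infinite_nat_iff_unbounded_le by auto
    then obtain r0 :: "nat \<Rightarrow> nat" where r0: "strict_mono r0" "\<And>k. \<bar>e (\<sigma> (r0 k)) \<bullet> v - c \<bullet> v\<bar> \<ge> \<eta>"
      using infinite_enumerate by blast
    obtain r1 \<beta> where r1: "strict_mono (r1 :: nat \<Rightarrow> nat)" "(\<lambda>k. e (\<sigma> (r0 (r1 k))) \<bullet> v) \<longlonglongrightarrow> \<beta>"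
      using bounded_imp_convergent_subsequence[OF bdd_inner[of "\<sigma> \<circ> r0" v]] by (auto simp: o_def)
    define \<tau> where "\<tau> = r0 \<circ> r1"
    have \<tau>: "strict_mono \<tau>" unfolding \<tau>_def using r0(1) r1(1) by (rule strict_mono_o)
    obtain c' where c': "c' \<in> closure (convex hull (range (\<lambda>k. e (\<sigma> (\<tau> k)))))"
      "\<And>v l. (\<lambda>k. e (\<sigma> (\<tau> k)) \<bullet> v) \<longlonglongrightarrow> l \<Longrightarrow> c' \<bullet> v = l"
      using bounded_sequence_hull_point[OF sub_bdd[of "\<lambda>k. \<sigma> (\<tau> k)"]] by metis
    \<comment> \<open>Both points lie in the closed hull of the sequence and have the same inner products
      with all its terms, so their difference is orthogonal to itself.\<close>
    let ?P = "{z. (c' - c) \<bullet> z = 0}"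
    have "e j \<in> ?P" for j
    proof -
      obtain l where l: "(\<lambda>k. e (\<sigma> k) \<bullet> e j) \<longlonglongrightarrow> l" using conv[of j] by (auto simp: convergent_def)
      have "(\<lambda>k. e (\<sigma> (\<tau> k)) \<bullet> e j) \<longlonglongrightarrow> l"
        using LIMSEQ_subseq_LIMSEQ[OF l \<tau>] by (simp add: o_def)
      then show ?thesis using c(2)[OF l] c'(2) by (simp add: inner_diff_left)
    qed
    then have "convex hull (range (\<lambda>k. e (s k))) \<subseteq> ?P" for s :: "nat \<Rightarrow> nat"
      by (intro hull_minimal convex_hyperplane) auto
    then have "closure (convex hull (range (\<lambda>k. e (s k)))) \<subseteq> ?P" for s :: "nat \<Rightarrow> nat"
      by (intro closure_minimal closed_hyperplane)
    then have "c \<in> ?P" "c' \<in> ?P" using c(1) c'(1) by (meson subsetD)+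
    then have "(c' - c) \<bullet> (c' - c) = 0" by (simp add: inner_diff_right)
    then have "c' = c" by simp
    moreover have "c' \<bullet> v = \<beta>" using r1(2) by (intro c'(2)) (simp add: \<tau>_def)
    moreover have "(\<lambda>k. \<bar>e (\<sigma> (r0 (r1 k))) \<bullet> v - c \<bullet> v\<bar>) \<longlonglongrightarrow> \<bar>\<beta> - c \<bullet> v\<bar>"
      by (intro tendsto_intros r1)
    then have "\<bar>\<beta> - c \<bullet> v\<bar> \<ge> \<eta>"
      using r0(2) by (intro LIMSEQ_le_const) auto
    ultimately show False using \<eta>(1) by simp
  qed
  then show ?thesis using that[OF \<sigma>, of c] by (simp add: weakly_converges_def o_def)
qed

section \<open>Ekeland's variational principle\<close>

text \<open>
  The form with a non-strict minimum of the perturbed function. The minimizer is the limit of a sequence that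
  almost minimizes \<open>f\<close> on a decreasing sequence of sets \<open>S z\<close> whose diameters tend to zero.
\<close>

lemma ekeland_variational_principle:
  fixes f :: "'a::metric_space \<Rightarrow> real"
  assumes C: "complete C" and cont: "continuous_on C f" and nonneg: "\<And>z. z \<in> C \<Longrightarrow> 0 \<le> f z"
    and a: "a \<in> C" and c: "c > 0"
  obtains z where "z \<in> C" and "f z + c * dist z a \<le> f a"
    and "\<And>y. y \<in> C \<Longrightarrow> f z \<le> f y + c * dist y z"
proof -
  define S where "S = (\<lambda>z. {y\<in>C. f y + c * dist y z \<le> f z})"
  have S_trans: "w \<in> S z" if "w \<in> S y" "y \<in> S z" for w y z
  proof -
    have "c * dist w z \<le> c * dist w y + c * dist y z"
      using c dist_triangle[of w z y] by (simp add: distrib_left[symmetric])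
    then show ?thesis using that by (auto simp: S_def)
  qed
  have S_refl: "z \<in> S z" if "z \<in> C" for z using that by (simp add: S_def)
  have step: "\<exists>y. y \<in> S z \<and> (\<forall>w\<in>S z. f y \<le> f w + (1/2)^n)" if "z \<in> C" for z and n :: nat
  proof -
    have bb: "bdd_below (f ` S z)" using nonneg by (intro bdd_belowI2[of _ 0]) (auto simp: S_def)
    have ne: "S z \<noteq> {}" using S_refl[OF that] by blast
    obtain y where "y \<in> S z" "f y < (INF w\<in>S z. f w) + (1/2)^n"
      using cINF_less_iff[OF ne bb, of "(INF w\<in>S z. f w) + (1/2)^n"] by auto
    moreover have "(INF w\<in>S z. f w) \<le> f w" if "w \<in> S z" for w
      using bb that by (rule cINF_lower)
    ultimately show ?thesis by force
  qed
  have "\<exists>s. s 0 = a \<and> (\<forall>n. s n \<in> C \<and> s (Suc n) \<in> S (s n) \<and> (\<forall>w\<in>S (s n). f (s (Suc n)) \<le> f w + (1/2)^n))"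
  proof -
    have "\<exists>s. \<forall>n. (s n \<in> C \<and> (n = 0 \<longrightarrow> s n = a)) \<and>
        (s (Suc n) \<in> S (s n) \<and> (\<forall>w\<in>S (s n). f (s (Suc n)) \<le> f w + (1/2)^n))"
    proof (rule dependent_nat_choice)
      show "\<exists>x. x \<in> C \<and> (0 = (0::nat) \<longrightarrow> x = a)" using a by auto
    next
      fix x and n :: nat assume "x \<in> C \<and> (n = 0 \<longrightarrow> x = a)"
      then obtain y where "y \<in> S x" "\<forall>w\<in>S x. f y \<le> f w + (1/2)^n" using step by blast
      then show "\<exists>y. (y \<in> C \<and> (Suc n = 0 \<longrightarrow> y = a)) \<and> (y \<in> S x \<and> (\<forall>w\<in>S x. f y \<le> f w + (1/2)^n))"
        by (intro exI[of _ y]) (auto simp: S_def)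
    qed
    then show ?thesis by auto
  qed
  then obtain s where s0: "s 0 = a" and sC: "\<And>n. s n \<in> C" and sS: "\<And>n. s (Suc n) \<in> S (s n)"
    and smin: "\<And>n w. w \<in> S (s n) \<Longrightarrow> f (s (Suc n)) \<le> f w + (1/2)^n" by metis
  have chain: "s m \<in> S (s n)" if "n \<le> m" for m n
    using that by (induction m rule: dec_induct) (auto intro: S_refl sC S_trans[OF sS])
  have "decseq (\<lambda>n. f (s n))"
    unfolding decseq_def
  proof (intro allI impI)
    fix m n :: nat assume "m \<le> n"
    then have "f (s n) + c * dist (s n) (s m) \<le> f (s m)" using chain by (auto simp: S_def)
    then show "f (s n) \<le> f (s m)" using c zero_le_dist[of "s n" "s m"]
      by (smt (verit) mult_nonneg_nonneg)
  qed
  then obtain F where F: "(\<lambda>n. f (s n)) \<longlonglongrightarrow> F" "\<And>n. F \<le> f (s n)"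
    using decseq_convergent[of "\<lambda>n. f (s n)" 0] nonneg sC by metis
  have "Cauchy s"
  proof (rule metric_CauchyI)
    fix e :: real assume e: "0 < e"
    then have "eventually (\<lambda>n. f (s n) < F + c * (e/2)) sequentially"
      using c by (intro order_tendstoD[OF F(1)]) auto
    then obtain N where N: "f (s N) < F + c * (e/2)" by (auto simp: eventually_sequentially)
    have "dist (s m) (s N) < e/2" if "m \<ge> N" for m
    proof -
      have "c * dist (s m) (s N) < c * (e/2)"
        using chain[OF that] N F(2)[of m] by (auto simp: S_def)
      then show ?thesis using c by simp
    qed
    then show "\<exists>M. \<forall>m\<ge>M. \<forall>n\<ge>M. dist (s m) (s n) < e"
      by (meson dist_triangle_half_l dist_commute)
  qed
  then obtain z where z: "z \<in> C" "s \<longlonglongrightarrow> z" using C sC unfolding complete_def by blast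
  have fz: "(\<lambda>n. f (s n)) \<longlonglongrightarrow> f z"
    using cont z sC by (auto simp: continuous_on_sequentially o_def)
  have zS: "z \<in> S (s n)" for n
  proof -
    have "(\<lambda>m. f (s m) + c * dist (s m) (s n)) \<longlonglongrightarrow> f z + c * dist z (s n)"
      by (intro tendsto_intros fz z)
    then have "f z + c * dist z (s n) \<le> f (s n)"
      using chain by (intro LIMSEQ_le_const2) (auto simp: S_def intro!: exI[of _ n])
    then show ?thesis using z by (simp add: S_def)
  qed
  have "f z \<le> f y + c * dist y z" if y: "y \<in> C" for y
  proof (rule ccontr)
    assume less: "\<not> ?thesis"
    then have yS: "y \<in> S (s n)" for n
      using y by (intro S_trans[OF _ zS]) (auto simp: S_def)
    have "c * dist y z \<le> (1/2)^n" for n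
    proof -
      have "f z + c * dist z (s (Suc n)) \<le> f (s (Suc n))" using zS[of "Suc n"] by (simp add: S_def)
      moreover have "0 \<le> c * dist z (s (Suc n))" using c by simp
      ultimately show ?thesis using smin[OF yS, of n] less by linarith
    qed
    moreover have "(\<lambda>n. (1/2::real)^n) \<longlonglongrightarrow> 0" by (intro LIMSEQ_power_zero) auto
    ultimately have "c * dist y z \<le> 0" by (intro LIMSEQ_le_const) auto
    then have "y = z" using c by (simp add: mult_le_0_iff)
    then show False using less by simp
  qed
  then show ?thesis using that[OF z(1)] zS[of 0] by (simp add: S_def s0)
qed

section \<open>\<open>\<epsilon>\<close>-normals and contingent cones\<close>

lemma eps_normals_iff:
  "xs \<in> eps_normals \<epsilon> x \<Omega> \<longleftrightarrow>
    (\<forall>\<eta>>\<epsilon>. \<exists>d>0. \<forall>u\<in>\<Omega>. dist u x < d \<longrightarrow> xs \<bullet> (u - x) \<le> \<eta> * norm (u - x))"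
  (is "?L \<longleftrightarrow> ?R")
proof
  assume L: ?L
  show ?R
  proof (intro allI impI)
    fix \<eta> :: real assume "\<epsilon> < \<eta>"
    then have "ereal \<epsilon> < ereal \<eta>" by simp
    then have "\<forall>\<^sub>F u in at x within \<Omega>. ereal (xs \<bullet> (u - x) / norm (u - x)) < ereal \<eta>"
      using L unfolding eps_normals_def mem_Collect_eq Limsup_le_iff by blast
    then obtain d where d: "d > 0" "\<And>u. u \<in> \<Omega> \<Longrightarrow> u \<noteq> x \<Longrightarrow> dist u x < d \<Longrightarrow> xs \<bullet> (u - x) / norm (u - x) < \<eta>"
      by (auto simp: eventually_at)
    have "xs \<bullet> (u - x) \<le> \<eta> * norm (u - x)" if "u \<in> \<Omega>" "dist u x < d" for u
      using d(2)[of u] that by (cases "u = x") (auto simp: divide_less_eq intro: less_imp_le)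
    then show "\<exists>d>0. \<forall>u\<in>\<Omega>. dist u x < d \<longrightarrow> xs \<bullet> (u - x) \<le> \<eta> * norm (u - x)"
      using d(1) by blast
  qed
next
  assume R: ?R
  have "\<forall>\<^sub>F u in at x within \<Omega>. ereal (xs \<bullet> (u - x) / norm (u - x)) < y" if y: "ereal \<epsilon> < y" for y
  proof -
    obtain \<eta> where \<eta>: "ereal \<epsilon> < ereal \<eta>" "ereal \<eta> < y" using ereal_dense2[OF y] by blast
    then obtain d where d: "d > 0" "\<And>u. u \<in> \<Omega> \<Longrightarrow> dist u x < d \<Longrightarrow> xs \<bullet> (u - x) \<le> \<eta> * norm (u - x)"
      using R by auto
    have "ereal (xs \<bullet> (u - x) / norm (u - x)) < y" if "u \<in> \<Omega>" "u \<noteq> x" "dist u x < d" for u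
    proof -
      have "xs \<bullet> (u - x) / norm (u - x) \<le> \<eta>" using d(2)[of u] that by (simp add: divide_le_eq)
      then show ?thesis using \<eta>(2) by (metis ereal_less_eq(3) le_less_trans)
    qed
    then show ?thesis using d(1) by (auto simp: eventually_at)
  qed
  then show ?L by (simp add: eps_normals_def Limsup_le_iff)
qed

lemma eps_normals_mono:
  assumes "xs \<in> eps_normals \<epsilon> x \<Omega>" and "\<epsilon> \<le> \<epsilon>'"
  shows "xs \<in> eps_normals \<epsilon>' x \<Omega>"
  using assms unfolding eps_normals_iff by (meson le_less_trans)

lemma eps_normals_scaleR:
  assumes xs: "xs \<in> eps_normals \<epsilon> x \<Omega>" and c: "c > 0"
  shows "c *\<^sub>R xs \<in> eps_normals (c * \<epsilon>) x \<Omega>"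
  unfolding eps_normals_iff
proof (intro allI impI)
  fix \<eta> assume "c * \<epsilon> < \<eta>"
  then have "\<epsilon> < \<eta> / c" using c by (simp add: field_simps)
  then obtain d where d: "d > 0" "\<And>u. u \<in> \<Omega> \<Longrightarrow> dist u x < d \<Longrightarrow> xs \<bullet> (u - x) \<le> \<eta> / c * norm (u - x)"
    using xs unfolding eps_normals_iff by meson
  have "(c *\<^sub>R xs) \<bullet> (u - x) \<le> \<eta> * norm (u - x)" if "u \<in> \<Omega>" "dist u x < d" for u
    using mult_left_mono[OF d(2)[OF that], of c] c by simp
  then show "\<exists>d>0. \<forall>u\<in>\<Omega>. dist u x < d \<longrightarrow> (c *\<^sub>R xs) \<bullet> (u - x) \<le> \<eta> * norm (u - x)"
    using d(1) by blast
qed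

text \<open>A quadratic error term in the inequality for \<open>\<epsilon>\<close>-normals is harmless.\<close>

lemma eps_normals_quadraticI:
  assumes r: "r > 0" and K: "K > 0"
    and le: "\<And>u. u \<in> \<Omega> \<Longrightarrow> dist u x < r \<Longrightarrow> xs \<bullet> (u - x) \<le> \<epsilon> * norm (u - x) + K * (norm (u - x))\<^sup>2"
  shows "xs \<in> eps_normals \<epsilon> x \<Omega>"
  unfolding eps_normals_iff
proof (intro allI impI)
  fix \<eta> assume \<eta>: "\<epsilon> < \<eta>"
  have "xs \<bullet> (u - x) \<le> \<eta> * norm (u - x)" if u: "u \<in> \<Omega>" "dist u x < min r ((\<eta> - \<epsilon>) / K)" for u
  proof -
    have "K * norm (u - x) \<le> \<eta> - \<epsilon>"
      using u(2) K by (simp add: dist_norm field_simps)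
    then have "K * norm (u - x) * norm (u - x) \<le> (\<eta> - \<epsilon>) * norm (u - x)"
      by (rule mult_right_mono) simp
    moreover have "xs \<bullet> (u - x) \<le> \<epsilon> * norm (u - x) + K * norm (u - x) * norm (u - x)"
      using le[OF u(1)] u(2) by (simp add: power2_eq_square mult.assoc)
    ultimately show ?thesis by (simp add: left_diff_distrib)
  qed
  moreover have "min r ((\<eta> - \<epsilon>) / K) > 0" using r K \<eta> by simp
  ultimately show "\<exists>d>0. \<forall>u\<in>\<Omega>. dist u x < d \<longrightarrow> xs \<bullet> (u - x) \<le> \<eta> * norm (u - x)" by blast
qed

lemma contingent_cone_approx:
  assumes "z \<in> contingent_cone x \<Omega>" and "\<eta> > 0"
  obtains q t where "q \<in> \<Omega>" and "t > 0" and "norm ((1 / t) *\<^sub>R (q - x) - z) < \<eta>"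
proof -
  obtain t w where t: "\<And>k. t k > 0" and w: "w \<longlonglongrightarrow> z" and in_\<Omega>: "\<And>k. x + t k *\<^sub>R w k \<in> \<Omega>"
    using assms(1) by (auto simp: contingent_cone_def downto_zero_def)
  obtain k where "norm (w k - z) < \<eta>" using LIMSEQ_D[OF w assms(2)] by blast
  then show ?thesis
    using that[of "x + t k *\<^sub>R w k" "t k"] in_\<Omega>[of k] t[of k] by simp
qed

lemma contingent_cone_scaleR:
  assumes "z \<in> contingent_cone x \<Omega>" and "c > 0"
  shows "c *\<^sub>R z \<in> contingent_cone x \<Omega>"
proof -
  obtain t w where t: "downto_zero t" and w: "w \<longlonglongrightarrow> z" and in_\<Omega>: "\<And>k. x + t k *\<^sub>R w k \<in> \<Omega>"
    using assms(1) by (auto simp: contingent_cone_def)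
  have "downto_zero (\<lambda>k. t k / c)"
    using t assms(2) tendsto_divide[of t 0 sequentially "\<lambda>_. c" c] by (auto simp: downto_zero_def)
  moreover have "(\<lambda>k. c *\<^sub>R w k) \<longlonglongrightarrow> c *\<^sub>R z" by (intro tendsto_intros w)
  moreover have "\<forall>k. x + (t k / c) *\<^sub>R (c *\<^sub>R w k) \<in> \<Omega>" using in_\<Omega> assms(2) by simp
  ultimately show ?thesis unfolding contingent_cone_def by blast
qed

lemma contingent_cone_diff:
  assumes "convex \<Omega>" and "x \<in> \<Omega>" and "w \<in> \<Omega>"
  shows "w - x \<in> contingent_cone x \<Omega>"
proof -
  have "x + inverse (real (Suc k)) *\<^sub>R (w - x) \<in> \<Omega>" for k
  proof -
    have "(1 - inverse (real (Suc k))) *\<^sub>R x + inverse (real (Suc k)) *\<^sub>R w \<in> \<Omega>"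
      using assms by (intro convexD_alt) (auto simp: inverse_le_1_iff)
    then show ?thesis by (simp add: algebra_simps)
  qed
  moreover have "downto_zero (\<lambda>k. inverse (real (Suc k)))"
    using LIMSEQ_inverse_real_of_nat by (simp add: downto_zero_def)
  ultimately show ?thesis
    unfolding contingent_cone_def by (intro CollectI exI[of _ "\<lambda>k. inverse (real (Suc k))"] exI[of _ "\<lambda>_. w - x"]) simp
qed

text \<open>
  Nonnegative combinations of feasible directions of a convex set are tangent. This is the source
  of the tangency condition on the dual elements in the fuzzy sum rule.
\<close>

lemma contingent_cone_combination:
  assumes cvx: "convex \<Omega>" and x: "x \<in> \<Omega>" and w: "w1 \<in> \<Omega>" "w2 \<in> \<Omega>" and st: "s \<ge> 0" "t \<ge> 0"
  shows "s *\<^sub>R (w1 - x) + t *\<^sub>R (w2 - x) \<in> contingent_cone x \<Omega>"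
proof (cases "s + t = 0")
  case True
  then have "s = 0" "t = 0" using st by auto
  then show ?thesis using contingent_cone_diff[OF cvx x x] by simp
next
  case False
  then have pos: "s + t > 0" using st by simp
  define m where "m = (s / (s + t)) *\<^sub>R w1 + (t / (s + t)) *\<^sub>R w2"
  have "m \<in> \<Omega>"
    unfolding m_def using cvx w st pos
    by (intro convexD) (auto simp: add_divide_distrib[symmetric])
  then have "(s + t) *\<^sub>R (m - x) \<in> contingent_cone x \<Omega>"
    by (intro contingent_cone_scaleR contingent_cone_diff cvx x pos)
  moreover have "(s + t) *\<^sub>R (m - x) = s *\<^sub>R (w1 - x) + t *\<^sub>R (w2 - x)"
    proof -
    have "(s + t) *\<^sub>R m = s *\<^sub>R w1 + t *\<^sub>R w2" using pos by (simp add: m_def scaleR_add_right)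
    then show ?thesis by (simp add: scaleR_diff_right scaleR_add_left)
  qed
  ultimately show ?thesis by simp
qed

section \<open>A fuzzy sum rule\<close>

text \<open>
  A first-order upper estimate, with quadratic remainder, of \<open>norm (h, max 0 b)\<close> at a point
  \<open>(g, a)\<close> where this expression is positive. It combines \<open>2 * N * M \<le> N\<^sup>2 + M\<^sup>2\<close> with
  the fact that the square of \<open>max 0 b\<close> is bounded above by its quadratic expansion for all \<open>a\<close>
  and \<open>b\<close>, whatever their signs.
\<close>

lemma norm_Pair_max_le:
  fixes g h :: "'a::real_inner" and a b :: real
  assumes pos: "norm (g, max 0 a) > 0"
  defines "N \<equiv> norm (g, max 0 a)"
  shows "norm (h, max 0 b) \<le> N + (g \<bullet> (h - g) + max 0 a * (b - a)) / N
    + ((norm (h - g))\<^sup>2 + (b - a)\<^sup>2) / (2 * N)"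
proof -
  have sq: "(max 0 b)\<^sup>2 \<le> (max 0 a)\<^sup>2 + 2 * max 0 a * (b - a) + (b - a)\<^sup>2"
  proof (cases "a \<ge> 0"; cases "b \<ge> 0")
    assume "\<not> 0 \<le> a" "0 \<le> b"
    then show ?thesis using power_mono[of b "b - a" 2] by simp
  next
    assume "\<not> 0 \<le> a" "\<not> 0 \<le> b"
    then show ?thesis by simp
  qed (simp_all add: power2_eq_square algebra_simps)
  have "(norm h)\<^sup>2 = (norm g)\<^sup>2 + 2 * (g \<bullet> (h - g)) + (norm (h - g))\<^sup>2"
    by (simp add: power2_norm_eq_inner inner_diff_left inner_diff_right inner_commute[of h g])
  moreover have sum: "(norm (k, c))\<^sup>2 = (norm k)\<^sup>2 + c\<^sup>2" for k :: 'a and c :: real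
    by (simp add: norm_Pair)
  ultimately have quad: "(norm (h, max 0 b))\<^sup>2 \<le> N\<^sup>2 + 2 * (g \<bullet> (h - g) + max 0 a * (b - a))
      + ((norm (h - g))\<^sup>2 + (b - a)\<^sup>2)"
    using sq unfolding N_def sum by simp
  have N: "N > 0" using pos by (simp add: N_def)
  have "2 * N * norm (h, max 0 b) \<le> N\<^sup>2 + (norm (h, max 0 b))\<^sup>2"
    using sum_squares_bound[of N "norm (h, max 0 b)"] by simp
  with quad have "2 * N * norm (h, max 0 b) \<le> 2 * N\<^sup>2 + 2 * (g \<bullet> (h - g) + max 0 a * (b - a))
      + ((norm (h - g))\<^sup>2 + (b - a)\<^sup>2)" by linarith
  then have "norm (h, max 0 b) \<le> (2 * N\<^sup>2 + 2 * (g \<bullet> (h - g) + max 0 a * (b - a))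
      + ((norm (h - g))\<^sup>2 + (b - a)\<^sup>2)) / (2 * N)"
    using N by (simp add: pos_le_divide_eq mult.commute)
  also have "\<dots> = N + (g \<bullet> (h - g) + max 0 a * (b - a)) / N
    + ((norm (h - g))\<^sup>2 + (b - a)\<^sup>2) / (2 * N)"
    using N by (simp add: field_simps power2_eq_square)
  finally show ?thesis .
qed


text \<open>
  The dual element \<open>xs\<close> is split, up to the factor \<open>lam\<close> and an error of order \<open>\<epsilon>\<close>, into
  tangent vectors \<open>a\<close> and \<open>e\<close>, which are the first components of approximate normals to the graphs of the
  two summands at nearby points. The factor \<open>lam\<close> may vanish, in which case \<open>e\<close> is a unit vector.
\<close>

lemma fuzzy_sum_rule:
  fixes \<Omega> :: "'a::{real_inner, complete_space} set"
    and S1 S2 :: "'a \<Rightarrow> 'b::{real_inner, complete_space} set"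
  assumes cvx: "convex \<Omega>" and \<epsilon>: "\<epsilon> > 0" and \<delta>: "\<delta> > 0" and r: "r > 0"
    and cl1: "closed (gph (restr S1 \<Omega>) \<inter> cball (x, v1) r)"
    and cl2: "closed (gph (restr S2 \<Omega>) \<inter> cball (x, v2) r)"
    and in1: "(x, v1) \<in> gph (restr S1 \<Omega>)" and in2: "(x, v2) \<in> gph (restr S2 \<Omega>)"
    and nrm: "(xs, - ys) \<in> eps_normals \<epsilon> (x, v1 + v2) (gph (restr (\<lambda>x. S1 x + S2 x) \<Omega>))"
    and tan: "xs \<in> contingent_cone x \<Omega>"
  obtains p1 u1 p2 u2 a e lam where
    "(p1, u1) \<in> gph (restr S1 \<Omega>)" "(p2, u2) \<in> gph (restr S2 \<Omega>)"
    "dist (p1, u1) (x, v1) < \<delta>" "dist (p2, u2) (x, v2) < \<delta>"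
    "a \<in> contingent_cone p1 \<Omega>" "e \<in> contingent_cone p2 \<Omega>"
    "(a, - (lam *\<^sub>R ys)) \<in> eps_normals (5 * \<epsilon>) (p1, u1) (gph (restr S1 \<Omega>))"
    "(e, - (lam *\<^sub>R ys)) \<in> eps_normals (5 * \<epsilon>) (p2, u2) (gph (restr S2 \<Omega>))"
    "0 \<le> lam" "(norm e)\<^sup>2 + lam\<^sup>2 = 1" "norm (a + e - lam *\<^sub>R xs) \<le> 2 * \<epsilon>"
proof -
  define A where "A = gph (restr S1 \<Omega>)"
  define B where "B = gph (restr S2 \<Omega>)"
  define g where "g = (xs, - ys)"
  define u0 where "u0 = (x, v1 + v2)"
  define L :: "('a \<times> 'b) \<times> ('a \<times> 'b) \<Rightarrow> 'a \<times> 'b"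
    where "L = (\<lambda>z. (fst (fst z), snd (fst z) + snd (snd z)))"
  define D :: "('a \<times> 'b) \<times> ('a \<times> 'b) \<Rightarrow> 'a" where "D = (\<lambda>z. fst (fst z) - fst (snd z))"
  obtain d where d: "d > 0"
    "\<And>u. u \<in> gph (restr (\<lambda>x. S1 x + S2 x) \<Omega>) \<Longrightarrow> dist u u0 < d \<Longrightarrow> g \<bullet> (u - u0) \<le> 2 * \<epsilon> * norm (u - u0)"
  proof -
    have "\<epsilon> < 2 * \<epsilon>" using \<epsilon> by simp
    then show ?thesis
      using that eps_normals_iff[THEN iffD1, OF nrm] unfolding g_def u0_def by blast
  qed
  obtain q t where q: "q \<in> \<Omega>" and t: "t > 0" and qt: "norm ((1 / t) *\<^sub>R (q - x) - xs) < \<epsilon>"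
    using contingent_cone_approx[OF tan \<epsilon>] .
  \<comment> \<open>The bounds keep the points in the closed parts of the graphs, \<open>\<delta>\<close>-close to the reference points,
    within the radius \<open>d\<close> of the normality inequality, and make \<open>(q - p1) / t\<close> close to \<open>(q - x) / t\<close>.\<close>
  define \<rho> where "\<rho> = Min {r, \<delta>, d / 4, t * \<epsilon>}"
  have \<rho>: "\<rho> > 0" "\<rho> \<le> r" "\<rho> \<le> \<delta>" "\<rho> \<le> d / 4" "\<rho> \<le> t * \<epsilon>"
    using r \<delta> d(1) t \<epsilon> by (auto simp: \<rho>_def)
  define C where "C = (A \<inter> cball (x, v1) \<rho>) \<times> (B \<inter> cball (x, v2) \<rho>)"
  \<comment> \<open>The value of \<open>\<phi>\<close> at the reference point; with slope \<open>\<epsilon>\<close> in Ekeland's principle it confines the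
    minimizer to distance \<open>\<rho> / 2\<close>, so that all nearby points of \<open>A \<times> B\<close> are in \<open>C\<close>.\<close>
  define \<nu> where "\<nu> = \<epsilon> * \<rho> / 2"
  have \<nu>: "\<nu> > 0" using \<epsilon> \<rho>(1) by (simp add: \<nu>_def)
  define \<psi> where "\<psi> = (\<lambda>z. g \<bullet> (L z - u0) - 2 * \<epsilon> * norm (L z - u0))"
  define \<phi> where "\<phi> = (\<lambda>z. norm (D z, max 0 (\<nu> - \<psi> z)))"
  define a0 where "a0 = ((x, v1), (x, v2))"
  have "closed (G \<inter> cball w \<rho>)" if "closed (G \<inter> cball w r)" for G :: "('a \<times> 'b) set" and w
  proof -
    have "G \<inter> cball w \<rho> = (G \<inter> cball w r) \<inter> cball w \<rho>" using \<rho>(2) by auto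
    then show ?thesis using that by (simp add: closed_Int)
  qed
  then have C: "complete C"
    unfolding C_def complete_eq_closed A_def B_def using cl1 cl2 by (intro closed_Times) auto
  have cont: "continuous_on C \<phi>"
    unfolding \<phi>_def \<psi>_def L_def D_def by (intro continuous_intros)
  have \<phi>0: "0 \<le> \<phi> z" for z by (simp add: \<phi>_def)
  have a0: "a0 \<in> C" using in1 in2 \<rho>(1) by (simp add: a0_def C_def A_def B_def)
  obtain z where zC: "z \<in> C" and za: "\<phi> z + \<epsilon> * dist z a0 \<le> \<phi> a0"
    and zmin: "\<And>y. y \<in> C \<Longrightarrow> \<phi> z \<le> \<phi> y + \<epsilon> * dist y z"
    by (rule ekeland_variational_principle[OF C cont \<phi>0 a0 \<epsilon>]) blast
  have "\<phi> a0 = \<nu>" using \<nu> by (simp add: \<phi>_def \<psi>_def D_def L_def a0_def u0_def flip: zero_prod_def)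
  moreover have "\<phi> z \<ge> 0" by (rule \<phi>0)
  ultimately have "\<epsilon> * dist z a0 \<le> \<epsilon> * (\<rho> / 2)" using za by (simp add: \<nu>_def)
  then have z_near: "dist z a0 \<le> \<rho> / 2" using \<epsilon> by simp
  obtain p1 u1 p2 u2 where z: "z = ((p1, u1), (p2, u2))" by (metis surj_pair)
  have near1: "dist (p1, u1) (x, v1) \<le> \<rho> / 2" and near2: "dist (p2, u2) (x, v2) \<le> \<rho> / 2"
    using z_near dist_fst_le[of z a0] dist_snd_le[of z a0] by (simp_all add: z a0_def)
  have pA: "(p1, u1) \<in> A" and pB: "(p2, u2) \<in> B" using zC by (auto simp: C_def z)
  have p\<Omega>: "p1 \<in> \<Omega>" "p2 \<in> \<Omega>"
    using pA pB by (auto simp: A_def B_def gph_def restr_def split: if_splits)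
  have \<phi>_pos: "\<phi> z > 0"
  proof (rule ccontr)
    assume "\<not> ?thesis"
    then have "\<phi> z = 0" by (simp add: \<phi>_def)
    then have eq: "p1 = p2" and ge: "\<nu> \<le> \<psi> z" by (auto simp: \<phi>_def D_def z zero_prod_def max_def split: if_splits)
    have "L z \<in> gph (restr (\<lambda>x. S1 x + S2 x) \<Omega>)"
      using pA pB eq by (auto simp: L_def z A_def B_def gph_def restr_def set_plus_intro split: if_splits)
    moreover have "dist (L z) u0 < d"
    proof -
      have "dist (L z) u0 \<le> dist p1 x + dist (u1 + u2) (v1 + v2)"
        by (simp add: L_def z u0_def dist_Pair_Pair sqrt_sum_squares_le_sum)
      also have "\<dots> \<le> dist p1 x + (dist u1 v1 + dist u2 v2)"
        by (intro add_left_mono dist_triangle_add)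
      also have "\<dots> \<le> \<rho> / 2 + (\<rho> / 2 + \<rho> / 2)"
        using near1 near2 dist_fst_le[of "(p1, u1)" "(x, v1)"] dist_snd_le[of "(p1, u1)" "(x, v1)"]
          dist_snd_le[of "(p2, u2)" "(x, v2)"] by (intro add_mono) auto
      also have "\<dots> < d" using \<rho>(1,4) by simp
      finally show ?thesis .
    qed
    ultimately have "\<psi> z \<le> 0" using d(2)[of "L z"] by (simp add: \<psi>_def)
    then show False using ge \<nu> by simp
  qed
  define e where "e = (1 / \<phi> z) *\<^sub>R (p1 - p2)"
  define lam where "lam = max 0 (\<nu> - \<psi> z) / \<phi> z"
  have lam0: "0 \<le> lam" using \<phi>_pos by (simp add: lam_def)
  have unit: "(norm e)\<^sup>2 + lam\<^sup>2 = 1"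
  proof -
    have "(norm (p1 - p2))\<^sup>2 + (max 0 (\<nu> - \<psi> z))\<^sup>2 = (\<phi> z)\<^sup>2"
      by (simp add: \<phi>_def D_def z norm_Pair)
    then show ?thesis using \<phi>_pos
      by (simp add: e_def lam_def power_divide add_divide_distrib[symmetric])
  qed
  then have "lam\<^sup>2 \<le> 1\<^sup>2" by (metis add.commute le_add_same_cancel1 power_one zero_le_power2)
  then have lam1: "lam \<le> 1" by (rule power2_le_imp_le) simp
  define K where "K = (1 + (norm g + 2 * \<epsilon>)\<^sup>2) / (2 * \<phi> z)"
  have K: "K > 0" using \<phi>_pos by (simp add: K_def add_pos_nonneg)
  \<comment> \<open>The minimality of \<open>z\<close> in first-order form. The coefficient \<open>3 * \<epsilon>\<close> collects the slope in Ekeland's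
    principle and the \<open>2 * \<epsilon>\<close> by which \<open>\<psi>\<close> deviates from a linear function.\<close>
  have first_order: "0 \<le> e \<bullet> (D y - D z) - lam * (g \<bullet> (L y - L z)) + 3 * \<epsilon> * n + K * n\<^sup>2"
    if y: "y \<in> C" and n: "dist y z = n" "norm (L y - L z) \<le> n" "norm (D y - D z) \<le> n" for y n
  proof -
    have n0: "0 \<le> n" using n(1) by auto
    define \<Delta> where "\<Delta> = \<psi> z - \<psi> y"
    have norms: "\<bar>norm (L y - u0) - norm (L z - u0)\<bar> \<le> n"
      using norm_triangle_ineq3[of "L y - u0" "L z - u0"] n(2) by simp
    have \<Delta>_eq: "\<Delta> = - (g \<bullet> (L y - L z)) + 2 * \<epsilon> * (norm (L y - u0) - norm (L z - u0))"
      by (simp add: \<Delta>_def \<psi>_def inner_diff_right algebra_simps)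
    have "2 * \<epsilon> * (norm (L y - u0) - norm (L z - u0)) \<le> 2 * \<epsilon> * n"
      using norms \<epsilon> by (intro mult_left_mono) auto
    then have \<Delta>_le: "\<Delta> \<le> - (g \<bullet> (L y - L z)) + 2 * \<epsilon> * n" using \<Delta>_eq by simp
    have "\<bar>\<Delta>\<bar> \<le> \<bar>g \<bullet> (L y - L z)\<bar> + 2 * \<epsilon> * \<bar>norm (L y - u0) - norm (L z - u0)\<bar>"
      using \<epsilon> unfolding \<Delta>_eq by (intro order_trans[OF abs_triangle_ineq]) (simp add: abs_mult)
    also have "\<dots> \<le> norm g * n + 2 * \<epsilon> * n"
      using norms n(2) \<epsilon> n0
      by (intro add_mono mult_left_mono order_trans[OF Cauchy_Schwarz_ineq2]) auto
    finally have "\<bar>\<Delta>\<bar> \<le> (norm g + 2 * \<epsilon>) * n" by (simp add: distrib_right)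
    then have "\<bar>\<Delta>\<bar>\<^sup>2 \<le> ((norm g + 2 * \<epsilon>) * n)\<^sup>2" by (rule power_mono) simp
    then have "\<Delta>\<^sup>2 \<le> (norm g + 2 * \<epsilon>)\<^sup>2 * n\<^sup>2" by (simp add: power_mult_distrib)
    moreover have "(norm (D y - D z))\<^sup>2 \<le> n\<^sup>2" using n(3) by (intro power_mono) auto
    ultimately have "(norm (D y - D z))\<^sup>2 + \<Delta>\<^sup>2 \<le> (1 + (norm g + 2 * \<epsilon>)\<^sup>2) * n\<^sup>2"
      by (simp add: distrib_right)
    then have quad: "((norm (D y - D z))\<^sup>2 + \<Delta>\<^sup>2) / (2 * \<phi> z) \<le> K * n\<^sup>2"
      using \<phi>_pos by (simp add: K_def divide_right_mono)
    have "\<phi> y \<le> \<phi> z + (D z \<bullet> (D y - D z) + max 0 (\<nu> - \<psi> z) * \<Delta>) / \<phi> z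
        + ((norm (D y - D z))\<^sup>2 + \<Delta>\<^sup>2) / (2 * \<phi> z)"
      using norm_Pair_max_le[of "D z" "\<nu> - \<psi> z" "D y" "\<nu> - \<psi> y"] \<phi>_pos
      by (simp add: \<phi>_def \<Delta>_def)
    also have "(D z \<bullet> (D y - D z) + max 0 (\<nu> - \<psi> z) * \<Delta>) / \<phi> z = e \<bullet> (D y - D z) + lam * \<Delta>"
      by (simp add: e_def lam_def D_def z add_divide_distrib)
    finally have "\<phi> y \<le> \<phi> z + (e \<bullet> (D y - D z) + lam * \<Delta>) + K * n\<^sup>2" using quad by linarith
    then have "0 \<le> e \<bullet> (D y - D z) + lam * \<Delta> + \<epsilon> * n + K * n\<^sup>2"
      using zmin[OF y] n(1) by simp
    moreover have "lam * \<Delta> \<le> lam * (- (g \<bullet> (L y - L z)) + 2 * \<epsilon> * n)"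
      using \<Delta>_le lam0 by (rule mult_left_mono)
    moreover have "lam * (2 * \<epsilon> * n) \<le> 2 * \<epsilon> * n"
      using lam1 lam0 \<epsilon> n0 by (simp add: mult_left_le_one_le)
    ultimately show ?thesis by (simp add: algebra_simps)
  qed
  \<comment> \<open>A substitute for \<open>xs\<close> that is tangent at \<open>p1\<close> instead of \<open>x\<close>.\<close>
  define w where "w = (1 / t) *\<^sub>R (q - p1)"
  define a where "a = lam *\<^sub>R w - e"
  have w: "norm (w - xs) \<le> 2 * \<epsilon>"
  proof -
    have "w - xs = ((1 / t) *\<^sub>R (q - x) - xs) + (1 / t) *\<^sub>R (x - p1)"
      by (simp add: w_def scaleR_diff_right)
    moreover have "norm ((1 / t) *\<^sub>R (x - p1)) \<le> \<epsilon>"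
    proof -
      have "norm (x - p1) \<le> t * \<epsilon>"
        using dist_fst_le[of "(p1, u1)" "(x, v1)"] near1 \<rho>(1,5) by (simp add: dist_norm norm_minus_commute)
      then show ?thesis using t by (simp add: pos_divide_le_eq mult.commute)
    qed
    ultimately show ?thesis
      using qt norm_triangle_ineq[of "(1 / t) *\<^sub>R (q - x) - xs" "(1 / t) *\<^sub>R (x - p1)"]
      by (metis add_mono less_imp_le mult_2 order_trans)
  qed
  have lamw: "norm (lam *\<^sub>R w - lam *\<^sub>R xs) \<le> 2 * \<epsilon>"
  proof -
    have "norm (lam *\<^sub>R w - lam *\<^sub>R xs) = lam * norm (w - xs)"
      using lam0 by (simp add: scaleR_diff_right[symmetric])
    also have "\<dots> \<le> norm (w - xs)" using lam0 lam1 by (simp add: mult_left_le_one_le)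
    finally show ?thesis using w by simp
  qed
  have tan1: "a \<in> contingent_cone p1 \<Omega>"
  proof -
    have "(lam / t) *\<^sub>R (q - p1) + (1 / \<phi> z) *\<^sub>R (p2 - p1) \<in> contingent_cone p1 \<Omega>"
      using lam0 t \<phi>_pos by (intro contingent_cone_combination cvx p\<Omega> q) auto
    also have "(lam / t) *\<^sub>R (q - p1) + (1 / \<phi> z) *\<^sub>R (p2 - p1) = a"
      by (simp add: a_def w_def e_def scaleR_diff_right)
    finally show ?thesis .
  qed
  have tan2: "e \<in> contingent_cone p2 \<Omega>"
    using contingent_cone_combination[OF cvx p\<Omega>(2) p\<Omega>(1) p\<Omega>(2), of "1 / \<phi> z" 0] \<phi>_pos by (simp add: e_def)
  \<comment> \<open>Moving only the point of \<open>A\<close>, or only the point of \<open>B\<close>, separates the two normals.\<close>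
  have nrm1: "(a, - (lam *\<^sub>R ys)) \<in> eps_normals (5 * \<epsilon>) (p1, u1) A"
  proof (rule eps_normals_quadraticI[of "\<rho> / 2" K])
    fix y assume y: "y \<in> A" "dist y (p1, u1) < \<rho> / 2"
    define h where "h = y - (p1, u1)"
    have h_fst: "norm (fst h) \<le> norm h" using norm_fst_le[of "fst h" "snd h"] by simp
    have "dist y (x, v1) \<le> \<rho>" using dist_triangle[of y "(x, v1)" "(p1, u1)"] y(2) near1 by simp
    then have yC: "(y, (p2, u2)) \<in> C" using y(1) zC by (simp add: C_def z dist_commute)
    have Dy: "D (y, (p2, u2)) - D z = fst h" by (simp add: D_def z h_def)
    have Ly: "L (y, (p2, u2)) - L z = h" by (simp add: L_def z h_def prod_eq_iff)
    have "dist (y, (p2, u2)) z = norm h" by (simp add: z dist_Pair_Pair h_def dist_norm)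
    then have "0 \<le> e \<bullet> fst h - lam * (g \<bullet> h) + 3 * \<epsilon> * norm h + K * (norm h)\<^sup>2"
      using first_order[OF yC, of "norm h"] h_fst unfolding Dy Ly by simp
    moreover have "(lam *\<^sub>R w - lam *\<^sub>R xs) \<bullet> fst h \<le> 2 * \<epsilon> * norm h"
      using h_fst lamw \<epsilon>
      by (intro order_trans[OF norm_cauchy_schwarz] mult_mono) auto
    moreover have "(a, - (lam *\<^sub>R ys)) \<bullet> h = lam * (g \<bullet> h) - e \<bullet> fst h + (lam *\<^sub>R w - lam *\<^sub>R xs) \<bullet> fst h"
      by (simp add: a_def g_def inner_prod_def inner_diff_left algebra_simps)
    ultimately show "(a, - (lam *\<^sub>R ys)) \<bullet> (y - (p1, u1))
        \<le> 5 * \<epsilon> * norm (y - (p1, u1)) + K * (norm (y - (p1, u1)))\<^sup>2"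
      by (simp add: h_def[symmetric])
  qed (use \<rho>(1) K in auto)
  have nrm2: "(e, - (lam *\<^sub>R ys)) \<in> eps_normals (5 * \<epsilon>) (p2, u2) B"
  proof (rule eps_normals_mono, rule eps_normals_quadraticI[of "\<rho> / 2" K])
    fix y assume y: "y \<in> B" "dist y (p2, u2) < \<rho> / 2"
    define h where "h = y - (p2, u2)"
    have h_fst: "norm (fst h) \<le> norm h" using norm_fst_le[of "fst h" "snd h"] by simp
    have h_snd: "norm (snd h) \<le> norm h" using norm_snd_le[of "snd h" "fst h"] by simp
    have "dist y (x, v2) \<le> \<rho>" using dist_triangle[of y "(x, v2)" "(p2, u2)"] y(2) near2 by simp
    then have yC: "((p1, u1), y) \<in> C" using y(1) zC by (simp add: C_def z dist_commute)
    have Dy: "D ((p1, u1), y) - D z = - fst h" by (simp add: D_def z h_def)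
    have Ly: "L ((p1, u1), y) - L z = (0, snd h)" by (simp add: L_def z h_def prod_eq_iff)
    have "dist ((p1, u1), y) z = norm h" by (simp add: z dist_Pair_Pair h_def dist_norm)
    then have "0 \<le> - (e \<bullet> fst h) + lam * (ys \<bullet> snd h) + 3 * \<epsilon> * norm h + K * (norm h)\<^sup>2"
      using first_order[OF yC, of "norm h"] h_fst h_snd unfolding Dy Ly
      by (simp add: g_def norm_Pair)
    then show "(e, - (lam *\<^sub>R ys)) \<bullet> (y - (p2, u2))
        \<le> 3 * \<epsilon> * norm (y - (p2, u2)) + K * (norm (y - (p2, u2)))\<^sup>2"
      by (simp add: h_def[symmetric] inner_prod_def)
  qed (use \<rho>(1) K \<epsilon> in auto)
  have "norm (a + e - lam *\<^sub>R xs) \<le> 2 * \<epsilon>" using lamw by (simp add: a_def)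
  moreover have "dist (p1, u1) (x, v1) < \<delta>" "dist (p2, u2) (x, v2) < \<delta>"
    using near1 near2 \<rho>(1,3) by linarith+
  ultimately show ?thesis
    using that[of p1 u1 p2 u2 a e lam] pA pB tan1 tan2 nrm1 nrm2 lam0 unit
    by (simp add: A_def B_def)
qed

section \<open>Passage to the limit\<close>

lemma weakly_converges_subseq:
  assumes "weakly_converges x l" and "strict_mono s"
  shows "weakly_converges (\<lambda>k. x (s k)) l"
  unfolding weakly_converges_def
proof
  fix v
  have "(\<lambda>k. x k \<bullet> v) \<longlonglongrightarrow> l \<bullet> v" using assms(1) by (simp add: weakly_converges_def)
  from LIMSEQ_subseq_LIMSEQ[OF this assms(2)] show "(\<lambda>k. x (s k) \<bullet> v) \<longlonglongrightarrow> l \<bullet> v"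
    by (simp add: o_def)
qed

lemma weakly_converges_add:
  assumes "weakly_converges x a" and "weakly_converges y b"
  shows "weakly_converges (\<lambda>k. x k + y k) (a + b)"
  using assms unfolding weakly_converges_def inner_add_left by (intro allI tendsto_add) simp_all

lemma weakly_converges_diff:
  assumes "weakly_converges x a" and "weakly_converges y b"
  shows "weakly_converges (\<lambda>k. x k - y k) (a - b)"
  using assms unfolding weakly_converges_def inner_diff_left by (intro allI tendsto_diff) simp_all

lemma weakly_converges_scaleR:
  assumes "c \<longlonglongrightarrow> c0" and "weakly_converges x a"
  shows "weakly_converges (\<lambda>k. c k *\<^sub>R x k) (c0 *\<^sub>R a)"
  using assms unfolding weakly_converges_def inner_scaleR_left by (intro allI tendsto_mult) simp_all

lemma tendsto_imp_weakly_converges: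
  assumes "x \<longlonglongrightarrow> a"
  shows "weakly_converges x a"
  unfolding weakly_converges_def by (intro allI tendsto_inner assms tendsto_const)

lemma closed_around_cball:
  fixes w :: "'a::metric_space"
  assumes "closed_around G w"
  obtains r where "r > 0" and "\<And>v s. dist v w < r \<Longrightarrow> s \<le> r \<Longrightarrow> closed (G \<inter> cball v s)"
proof -
  obtain W where W: "w \<in> interior W" "closed (G \<inter> W)"
    using assms by (auto simp: closed_around_def)
  obtain R where R: "R > 0" "cball w R \<subseteq> W" using W(1) mem_interior_cball by blast
  have "closed (G \<inter> cball v s)" if "dist v w < R / 2" "s \<le> R / 2" for v s
  proof -
    have "u \<in> cball w R" if "u \<in> cball v s" for u
      using dist_triangle[of w u v] that \<open>dist v w < R / 2\<close> \<open>s \<le> R / 2\<close> by (simp add: dist_commute)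
    then have "cball v s \<subseteq> W" using R(2) by blast
    then have "G \<inter> cball v s = (G \<inter> W) \<inter> cball v s" by blast
    then show ?thesis using W(2) by (simp add: closed_Int)
  qed
  then show ?thesis using that[of "R / 2"] R(1) by simp
qed

lemma PSNC_D:
  assumes psnc: "PSNC S \<Omega> x0 y0" and small: "\<And>k. \<epsilon> k < 1"
    and rn: "rel_normal_seq S \<Omega> x0 y0 \<epsilon> x y xs ys" and xs: "weakly_converges xs 0" and ys: "ys \<longlonglongrightarrow> 0"
  shows "(\<lambda>k. norm (xs k)) \<longlonglongrightarrow> 0"
proof -
  have "\<forall>k. \<epsilon> k \<in> {0<..<1}" using small rn by (simp add: rel_normal_seq_def downto_zero_def)
  with rn xs ys show ?thesis
    using psnc[unfolded PSNC_def, THEN spec[of _ \<epsilon>], THEN spec[of _ x], THEN spec[of _ y],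
      THEN spec[of _ xs], THEN spec[of _ ys], THEN mp] by simp
qed

text \<open>
  From sequences defining an element of the coderivative of the sum, sequences defining elements of
  the coderivatives of the summands, with a subsequence of the given \<open>ys\<close> in both. Only the boundedness
  of \<open>ys\<close> is used, not the mode of its convergence.
\<close>

lemma sum_coderivative_sequences:
  fixes \<Omega> :: "'a::{real_inner, complete_space} set"
    and S1 S2 :: "'a \<Rightarrow> 'b::{real_inner, complete_space} set"
  assumes cvx: "convex \<Omega>"
    and isc: "inner_semicontinuous (sum_decomposition S1 S2) (\<Omega> \<times> UNIV) (x0, y0) (y1, y2)"
    and cl1: "closed_around (gph (restr S1 \<Omega>)) (x0, y1)"
    and cl2: "closed_around (gph (restr S2 \<Omega>)) (x0, y2)"
    and psnc: "PSNC S1 \<Omega> x0 y1 \<or> PSNC S2 \<Omega> x0 y2"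
    and qc: "mixed_coderivative S1 \<Omega> x0 y1 0 \<inter> uminus ` mixed_coderivative S2 \<Omega> x0 y2 0 = {0}"
    and rn: "rel_normal_seq (\<lambda>x. S1 x + S2 x) \<Omega> x0 y0 \<epsilon> x y xs ys"
    and xs: "weakly_converges xs xstar" and ys: "bounded (range ys)"
  obtains s \<epsilon>' p1 u1 xs1 l1 p2 u2 xs2 l2 where "strict_mono (s :: nat \<Rightarrow> nat)"
    and "rel_normal_seq S1 \<Omega> x0 y1 \<epsilon>' p1 u1 xs1 (\<lambda>k. ys (s k))" and "weakly_converges xs1 l1"
    and "rel_normal_seq S2 \<Omega> x0 y2 \<epsilon>' p2 u2 xs2 (\<lambda>k. ys (s k))" and "weakly_converges xs2 l2"
    and "xstar = l1 + l2"
proof -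
  have \<epsilon>: "\<And>k. \<epsilon> k > 0" "\<epsilon> \<longlonglongrightarrow> 0" using rn by (auto simp: rel_normal_seq_def downto_zero_def)
  have xy: "(\<lambda>k. (x k, y k)) \<longlonglongrightarrow> (x0, y0)" using rn by (simp add: rel_normal_seq_def)
  have x: "x \<longlonglongrightarrow> x0" using tendsto_fst[OF xy] by simp
  have x\<Omega>: "x k \<in> \<Omega>" and yS: "y k \<in> S1 (x k) + S2 (x k)" for k
    using rn by (auto simp: rel_normal_seq_def gph_def restr_def split: if_splits)
  have nrm: "(xs k, - ys k) \<in> eps_normals (\<epsilon> k) (x k, y k) (gph (restr (\<lambda>x. S1 x + S2 x) \<Omega>))"
    and tan: "xs k \<in> contingent_cone (x k) \<Omega>" for k
    using rn by (auto simp: rel_normal_seq_def)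
  have decomp: "w \<in> sum_decomposition S1 S2 (x k, y k) \<longleftrightarrow>
      fst w \<in> S1 (x k) \<and> snd w \<in> S2 (x k) \<and> fst w + snd w = y k" for w k
    by (cases w) (simp add: sum_decomposition_def)
  have adm: "(x k, y k) \<in> \<Omega> \<times> UNIV \<and> sum_decomposition S1 S2 (x k, y k) \<noteq> {}" for k
  proof -
    obtain c d where "c \<in> S1 (x k)" "d \<in> S2 (x k)" "y k = c + d"
      using yS[of k] by (rule set_plus_elim)
    then have "(c, d) \<in> sum_decomposition S1 S2 (x k, y k)" unfolding decomp by simp
    then show ?thesis using x\<Omega>[of k] by blast
  qed
  have "\<exists>v. (\<forall>k. v k \<in> sum_decomposition S1 S2 (x k, y k)) \<and> v \<longlonglongrightarrow> (y1, y2)"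
    using isc[unfolded inner_semicontinuous_def, THEN spec, of "\<lambda>k. (x k, y k)"] xy adm by simp
  then obtain v where v: "\<And>k. v k \<in> sum_decomposition S1 S2 (x k, y k)" "v \<longlonglongrightarrow> (y1, y2)"
    by blast
  define a where "a = (\<lambda>k. fst (v k))"
  define b where "b = (\<lambda>k. snd (v k))"
  have ab: "a k \<in> S1 (x k)" "b k \<in> S2 (x k)" "a k + b k = y k" for k
    using decomp[THEN iffD1, OF v(1)[of k]] by (simp_all add: a_def b_def)
  have a: "a \<longlonglongrightarrow> y1" and b: "b \<longlonglongrightarrow> y2"
    using tendsto_fst[OF v(2)] tendsto_snd[OF v(2)] by (auto simp: a_def b_def)
  obtain r1 where r1: "r1 > 0"
    "\<And>v s. dist v (x0, y1) < r1 \<Longrightarrow> s \<le> r1 \<Longrightarrow> closed (gph (restr S1 \<Omega>) \<inter> cball v s)"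
    using closed_around_cball[OF cl1] by blast
  obtain r2 where r2: "r2 > 0"
    "\<And>v s. dist v (x0, y2) < r2 \<Longrightarrow> s \<le> r2 \<Longrightarrow> closed (gph (restr S2 \<Omega>) \<inter> cball v s)"
    using closed_around_cball[OF cl2] by blast
  \<comment> \<open>The bound \<open>1/5\<close> makes the errors \<open>5 * \<epsilon>\<close> admissible for the PSNC property.\<close>
  have "\<forall>\<^sub>F k in sequentially. dist (x k, a k) (x0, y1) < r1 \<and> dist (x k, b k) (x0, y2) < r2 \<and> \<epsilon> k < 1/5"
    using x a b \<epsilon>(2) r1(1) r2(1)
    by (intro eventually_conj tendstoD tendsto_Pair order_tendstoD(2)[of \<epsilon> 0]) auto
  then obtain N where N: "\<And>k. k \<ge> N \<Longrightarrow> dist (x k, a k) (x0, y1) < r1"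
    "\<And>k. k \<ge> N \<Longrightarrow> dist (x k, b k) (x0, y2) < r2" "\<And>k. k \<ge> N \<Longrightarrow> \<epsilon> k < 1/5"
    unfolding eventually_sequentially by blast
  define h where "h = (\<lambda>k. inverse (real (Suc k)))"
  have h: "h k > 0" "h \<longlonglongrightarrow> 0" for k
    unfolding h_def using LIMSEQ_inverse_real_of_nat by auto
  define Q where "Q = (\<lambda>k p1 u1 p2 u2 c e lam.
    (p1, u1) \<in> gph (restr S1 \<Omega>) \<and> (p2, u2) \<in> gph (restr S2 \<Omega>) \<and>
    dist (p1, u1) (x (k + N), a (k + N)) < h k \<and> dist (p2, u2) (x (k + N), b (k + N)) < h k \<and>
    c \<in> contingent_cone p1 \<Omega> \<and> e \<in> contingent_cone p2 \<Omega> \<and>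
    (c, - (lam *\<^sub>R ys (k + N))) \<in> eps_normals (5 * \<epsilon> (k + N)) (p1, u1) (gph (restr S1 \<Omega>)) \<and>
    (e, - (lam *\<^sub>R ys (k + N))) \<in> eps_normals (5 * \<epsilon> (k + N)) (p2, u2) (gph (restr S2 \<Omega>)) \<and>
    0 \<le> lam \<and> (norm e)\<^sup>2 + lam\<^sup>2 = 1 \<and> norm (c + e - lam *\<^sub>R xs (k + N)) \<le> 2 * \<epsilon> (k + N))"
  have "\<forall>k. \<exists>p1 u1 p2 u2 c e lam. Q k p1 u1 p2 u2 c e lam"
  proof
    fix k
    have g: "(x (k + N), a (k + N)) \<in> gph (restr S1 \<Omega>)" "(x (k + N), b (k + N)) \<in> gph (restr S2 \<Omega>)"
      using ab x\<Omega> by (auto simp: gph_def restr_def)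
    have r: "min r1 r2 > 0" using r1(1) r2(1) by simp
    have c1: "closed (gph (restr S1 \<Omega>) \<inter> cball (x (k + N), a (k + N)) (min r1 r2))"
      using N(1) by (intro r1(2)) auto
    have c2: "closed (gph (restr S2 \<Omega>) \<inter> cball (x (k + N), b (k + N)) (min r1 r2))"
      using N(2) by (intro r2(2)) auto
    have n: "(xs (k + N), - ys (k + N)) \<in> eps_normals (\<epsilon> (k + N)) (x (k + N), a (k + N) + b (k + N))
        (gph (restr (\<lambda>x. S1 x + S2 x) \<Omega>))" using nrm ab(3) by simp
    show "\<exists>p1 u1 p2 u2 c e lam. Q k p1 u1 p2 u2 c e lam"
      by (rule fuzzy_sum_rule[OF cvx \<epsilon>(1) h(1) r c1 c2 g n tan]) (unfold Q_def, blast)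
  qed
  then obtain p1 u1 p2 u2 c e lam where Q: "\<And>k. Q k (p1 k) (u1 k) (p2 k) (u2 k) (c k) (e k) (lam k)"
    by metis
  have gph1: "(p1 k, u1 k) \<in> gph (restr S1 \<Omega>)" and gph2: "(p2 k, u2 k) \<in> gph (restr S2 \<Omega>)"
    and dist1: "dist (p1 k, u1 k) (x (k + N), a (k + N)) < h k"
    and dist2: "dist (p2 k, u2 k) (x (k + N), b (k + N)) < h k"
    and tan1: "c k \<in> contingent_cone (p1 k) \<Omega>" and tan2: "e k \<in> contingent_cone (p2 k) \<Omega>"
    and nrm1: "(c k, - (lam k *\<^sub>R ys (k + N))) \<in> eps_normals (5 * \<epsilon> (k + N)) (p1 k, u1 k) (gph (restr S1 \<Omega>))"
    and nrm2: "(e k, - (lam k *\<^sub>R ys (k + N))) \<in> eps_normals (5 * \<epsilon> (k + N)) (p2 k, u2 k) (gph (restr S2 \<Omega>))"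
    and lam0: "0 \<le> lam k" and unit: "(norm (e k))\<^sup>2 + (lam k)\<^sup>2 = 1"
    and sum_le: "norm (c k + e k - lam k *\<^sub>R xs (k + N)) \<le> 2 * \<epsilon> (k + N)" for k
    using Q[of k] unfolding Q_def by blast+
  have lim: "(\<lambda>k. (p k, u k)) \<longlonglongrightarrow> (x0, yy)"
    if "\<And>k. dist (p k, u k) (x (k + N), w (k + N)) < h k" "w \<longlonglongrightarrow> yy"
    for p u and w :: "nat \<Rightarrow> 'b" and yy
  proof (rule Lim_transform[where g = "\<lambda>k. (x (k + N), w (k + N))"])
    show "(\<lambda>k. (x (k + N), w (k + N))) \<longlonglongrightarrow> (x0, yy)"
      by (intro tendsto_Pair LIMSEQ_ignore_initial_segment x that)
    show "(\<lambda>k. (p k, u k) - (x (k + N), w (k + N))) \<longlonglongrightarrow> 0"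
    proof (rule Lim_null_comparison[OF _ h(2)])
      show "\<forall>\<^sub>F k in sequentially. norm ((p k, u k) - (x (k + N), w (k + N))) \<le> h k"
        using that(1) by (intro always_eventually allI) (simp add: dist_norm less_imp_le)
    qed
  qed
  have \<epsilon>N: "(\<lambda>k. \<epsilon> (k + N)) \<longlonglongrightarrow> 0" by (rule LIMSEQ_ignore_initial_segment[OF \<epsilon>(2)])
  \<comment> \<open>The factors \<open>m\<close> are constantly 1 in the case \<open>l = 0\<close> and the reciprocals of \<open>lam\<close> in the case \<open>l > 0\<close>.\<close>
  have rel: "rel_normal_seq S \<Omega> x0 yy (\<lambda>k. m k * (5 * \<epsilon> (s k + N))) (\<lambda>k. p (s k)) (\<lambda>k. u (s k))
      (\<lambda>k. m k *\<^sub>R f (s k)) (\<lambda>k. (m k * lam (s k)) *\<^sub>R ys (s k + N))"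
    if s: "strict_mono s" and m: "\<And>k. m k > 0" "m \<longlonglongrightarrow> m0"
      and gph: "\<And>k. (p k, u k) \<in> gph (restr S \<Omega>)" and pu: "(\<lambda>k. (p k, u k)) \<longlonglongrightarrow> (x0, yy)"
      and tan: "\<And>k. f k \<in> contingent_cone (p k) \<Omega>"
      and nrm: "\<And>k. (f k, - (lam k *\<^sub>R ys (k + N))) \<in> eps_normals (5 * \<epsilon> (k + N)) (p k, u k) (gph (restr S \<Omega>))"
    for S :: "'a \<Rightarrow> 'b set" and yy s m m0 p u f
  proof -
    have "(\<lambda>k. m k * (5 * \<epsilon> (s k + N))) \<longlonglongrightarrow> m0 * (5 * 0)"
      using LIMSEQ_subseq_LIMSEQ[OF \<epsilon>N s] by (intro tendsto_mult m tendsto_const) (simp add: o_def)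
    then have "downto_zero (\<lambda>k. m k * (5 * \<epsilon> (s k + N)))"
      using m(1) \<epsilon>(1) by (simp add: downto_zero_def)
    moreover have "(\<lambda>k. (p (s k), u (s k))) \<longlonglongrightarrow> (x0, yy)"
      using LIMSEQ_subseq_LIMSEQ[OF pu s] by (simp add: o_def)
    moreover have "(m k *\<^sub>R f (s k), - ((m k * lam (s k)) *\<^sub>R ys (s k + N)))
        \<in> eps_normals (m k * (5 * \<epsilon> (s k + N))) (p (s k), u (s k)) (gph (restr S \<Omega>))" for k
      using eps_normals_scaleR[OF nrm m(1)] by simp
    ultimately show ?thesis
      unfolding rel_normal_seq_def using gph contingent_cone_scaleR[OF tan m(1)] by simp
  qed
  note rel1 = rel[OF _ _ _ gph1 lim[OF dist1 a] tan1 nrm1]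
    and rel2 = rel[OF _ _ _ gph2 lim[OF dist2 b] tan2 nrm2]
  have e_le: "norm (e k) \<le> 1" for k
  proof (rule power2_le_imp_le)
    show "(norm (e k))\<^sup>2 \<le> 1\<^sup>2" using unit[of k] zero_le_power2[of "lam k"] unfolding power_one by linarith
  qed simp
  have lam1: "lam k \<le> 1" for k
  proof (rule power2_le_imp_le)
    show "(lam k)\<^sup>2 \<le> 1\<^sup>2" using unit[of k] zero_le_power2[of "norm (e k)"] unfolding power_one by linarith
  qed simp
  have "bounded (range e)" using e_le by (auto simp: bounded_iff)
  then obtain s1 e0 where s1: "strict_mono (s1 :: nat \<Rightarrow> nat)" "weakly_converges (e \<circ> s1) e0"
    by (rule bounded_imp_weakly_convergent_subsequence)
  have "bounded (range (lam \<circ> s1))" using lam0 lam1 by (auto simp: bounded_iff intro!: exI[of _ 1])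
  then obtain s2 l where s2: "strict_mono (s2 :: nat \<Rightarrow> nat)" "((lam \<circ> s1) \<circ> s2) \<longlonglongrightarrow> l"
    using bounded_imp_convergent_subsequence by blast
  define s where "s = s1 \<circ> s2"
  have s: "strict_mono s" unfolding s_def using s1(1) s2(1) by (rule strict_mono_o)
  have e_lim: "weakly_converges (\<lambda>k. e (s k)) e0"
    using weakly_converges_subseq[OF s1(2) s2(1)] by (simp add: s_def o_def)
  have lam_lim: "(\<lambda>k. lam (s k)) \<longlonglongrightarrow> l" using s2(2) by (simp add: s_def o_def)
  have "strict_mono (\<lambda>k. s k + N)" using s by (simp add: strict_mono_def)
  then have xs_lim: "weakly_converges (\<lambda>k. xs (s k + N)) xstar" by (rule weakly_converges_subseq[OF xs])
  have diff0: "(\<lambda>k. c (s k) + e (s k) - lam (s k) *\<^sub>R xs (s k + N)) \<longlonglongrightarrow> 0"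
  proof (rule Lim_null_comparison)
    show "\<forall>\<^sub>F k in sequentially. norm (c (s k) + e (s k) - lam (s k) *\<^sub>R xs (s k + N)) \<le> 2 * \<epsilon> (s k + N)"
      using sum_le by simp
    show "(\<lambda>k. 2 * \<epsilon> (s k + N)) \<longlonglongrightarrow> 0"
      using tendsto_mult[OF tendsto_const[of 2] LIMSEQ_subseq_LIMSEQ[OF \<epsilon>N s]] by (simp add: o_def)
  qed
  have c_lim: "weakly_converges (\<lambda>k. c (s k)) (l *\<^sub>R xstar - e0)"
    using weakly_converges_add[OF tendsto_imp_weakly_converges[OF diff0]
      weakly_converges_diff[OF weakly_converges_scaleR[OF lam_lim xs_lim] e_lim]] by simp
  \<comment> \<open>A degenerate limit is excluded by the qualification condition and the PSNC property.\<close>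
  have "l \<noteq> 0"
  proof
    assume "l = 0"
    have to0: "(\<lambda>k. lam (s k) *\<^sub>R f (s k + N)) \<longlonglongrightarrow> 0" if bdd: "bounded (range f)" for f :: "nat \<Rightarrow> 'c::real_normed_vector"
    proof -
      obtain M where M: "\<And>k. norm (f k) \<le> M" using bdd by (auto simp: bounded_iff)
      show ?thesis
      proof (rule Lim_null_comparison)
        show "\<forall>\<^sub>F k in sequentially. norm (lam (s k) *\<^sub>R f (s k + N)) \<le> lam (s k) * M"
          using lam0 M by (intro always_eventually) (auto intro: mult_left_mono)
        show "(\<lambda>k. lam (s k) * M) \<longlonglongrightarrow> 0"
          using tendsto_mult_right[OF lam_lim, of M] \<open>l = 0\<close> by simp
      qed
    qed
    have one: "(\<lambda>_::nat. 1::real) \<longlonglongrightarrow> 1" by simp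
    have rn1: "rel_normal_seq S1 \<Omega> x0 y1 (\<lambda>k. 5 * \<epsilon> (s k + N)) (\<lambda>k. p1 (s k)) (\<lambda>k. u1 (s k))
        (\<lambda>k. c (s k)) (\<lambda>k. lam (s k) *\<^sub>R ys (s k + N))"
      using rel1[OF s _ one] by simp
    have rn2: "rel_normal_seq S2 \<Omega> x0 y2 (\<lambda>k. 5 * \<epsilon> (s k + N)) (\<lambda>k. p2 (s k)) (\<lambda>k. u2 (s k))
        (\<lambda>k. e (s k)) (\<lambda>k. lam (s k) *\<^sub>R ys (s k + N))"
      using rel2[OF s _ one] by simp
    have c_lim0: "weakly_converges (\<lambda>k. c (s k)) (- e0)" using c_lim \<open>l = 0\<close> by simp
    have "- e0 \<in> mixed_coderivative S1 \<Omega> x0 y1 0"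
      unfolding mixed_coderivative_def using rn1 c_lim0 to0[OF ys] by blast
    moreover have "e0 \<in> mixed_coderivative S2 \<Omega> x0 y2 0"
      unfolding mixed_coderivative_def using rn2 e_lim to0[OF ys] by blast
    ultimately have "- e0 \<in> {0}" unfolding qc[symmetric] by (intro IntI imageI)
    then have "e0 = 0" by simp
    have small: "5 * \<epsilon> (s k + N) < 1" for k using N(3)[of "s k + N"] by simp
    have e_to0: "(\<lambda>k. norm (e (s k))) \<longlonglongrightarrow> 0"
      using psnc
    proof
      assume "PSNC S2 \<Omega> x0 y2"
      then show ?thesis
        using e_lim unfolding \<open>e0 = 0\<close> by (rule PSNC_D[OF _ small rn2 _ to0[OF ys]])
    next
      assume "PSNC S1 \<Omega> x0 y1"
      then have "(\<lambda>k. norm (c (s k))) \<longlonglongrightarrow> 0"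
        using c_lim0 unfolding \<open>e0 = 0\<close> minus_zero by (rule PSNC_D[OF _ small rn1 _ to0[OF ys]])
      then have "(\<lambda>k. c (s k)) \<longlonglongrightarrow> 0" by (rule tendsto_norm_zero_cancel)
      then have "(\<lambda>k. (c (s k) + e (s k) - lam (s k) *\<^sub>R xs (s k + N)) - c (s k)
          + lam (s k) *\<^sub>R xs (s k + N)) \<longlonglongrightarrow> 0 - 0 + 0"
        by (intro tendsto_intros diff0 to0 weakly_converges_imp_bounded[OF xs])
      then show ?thesis by (intro tendsto_norm_zero) simp
    qed
    have "(\<lambda>k. (norm (e (s k)))\<^sup>2 + (lam (s k))\<^sup>2) \<longlonglongrightarrow> 0\<^sup>2 + l\<^sup>2"
      by (intro tendsto_intros e_to0 lam_lim)
    then show False using \<open>l = 0\<close> by (simp add: unit LIMSEQ_const_iff)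
  qed
  moreover have "l \<ge> 0" using lam0 by (intro LIMSEQ_le_const[OF lam_lim]) auto
  ultimately have l: "l > 0" by simp
  then have "\<forall>\<^sub>F k in sequentially. lam (s k) > 0" by (intro order_tendstoD(1)[OF lam_lim])
  then obtain M where M: "\<And>k. k \<ge> M \<Longrightarrow> lam (s k) > 0" unfolding eventually_sequentially by blast
  define \<tau> where "\<tau> = (\<lambda>k. s (k + M))"
  have \<tau>: "strict_mono \<tau>" using s by (simp add: strict_mono_def \<tau>_def)
  have shift: "strict_mono (\<lambda>k. k + M)" by (simp add: strict_mono_def)
  define m where "m = (\<lambda>k. 1 / lam (\<tau> k))"
  have m: "m k > 0" "m k * lam (\<tau> k) = 1" for k using M[of "k + M"] by (simp_all add: m_def \<tau>_def)
  have m_lim: "m \<longlonglongrightarrow> 1 / l"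
    unfolding m_def \<tau>_def using l by (intro tendsto_divide LIMSEQ_ignore_initial_segment[OF lam_lim]) auto
  have rn1: "rel_normal_seq S1 \<Omega> x0 y1 (\<lambda>k. m k * (5 * \<epsilon> (\<tau> k + N))) (\<lambda>k. p1 (\<tau> k)) (\<lambda>k. u1 (\<tau> k))
      (\<lambda>k. m k *\<^sub>R c (\<tau> k)) (\<lambda>k. ys (\<tau> k + N))"
    using rel1[OF \<tau> m(1) m_lim] by (simp add: m(2))
  have rn2: "rel_normal_seq S2 \<Omega> x0 y2 (\<lambda>k. m k * (5 * \<epsilon> (\<tau> k + N))) (\<lambda>k. p2 (\<tau> k)) (\<lambda>k. u2 (\<tau> k))
      (\<lambda>k. m k *\<^sub>R e (\<tau> k)) (\<lambda>k. ys (\<tau> k + N))"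
    using rel2[OF \<tau> m(1) m_lim] by (simp add: m(2))
  have w1: "weakly_converges (\<lambda>k. m k *\<^sub>R c (\<tau> k)) ((1 / l) *\<^sub>R (l *\<^sub>R xstar - e0))"
    using weakly_converges_subseq[OF c_lim shift] unfolding \<tau>_def
    by (intro weakly_converges_scaleR m_lim)
  have w2: "weakly_converges (\<lambda>k. m k *\<^sub>R e (\<tau> k)) ((1 / l) *\<^sub>R e0)"
    using weakly_converges_subseq[OF e_lim shift] unfolding \<tau>_def
    by (intro weakly_converges_scaleR m_lim)
  have "xstar = (1 / l) *\<^sub>R (l *\<^sub>R xstar - e0) + (1 / l) *\<^sub>R e0"
    using l by (simp add: scaleR_diff_right)
  moreover have "strict_mono (\<lambda>k. \<tau> k + N)" using \<tau> by (simp add: strict_mono_def)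
  ultimately show ?thesis using that rn1 rn2 w1 w2 by blast
qed

theorem theorem4p9:
  fixes \<Omega> :: "'a::{real_inner, complete_space} set"
    and S1 S2 :: "'a \<Rightarrow> 'b::{real_inner, complete_space} set"
    and x0 :: 'a and y0 y1 y2 :: 'b
  assumes "closed \<Omega>" and "convex \<Omega>"
    and "(x0, y0) \<in> gph (restr (\<lambda>x. S1 x + S2 x) \<Omega>)"
    and "(y1, y2) \<in> sum_decomposition S1 S2 (x0, y0)"
    and "inner_semicontinuous (sum_decomposition S1 S2) (\<Omega> \<times> UNIV) (x0, y0) (y1, y2)"
    and "closed_around (gph (restr S1 \<Omega>)) (x0, y1)"
    and "closed_around (gph (restr S2 \<Omega>)) (x0, y2)"
    and "PSNC S1 \<Omega> x0 y1 \<or> PSNC S2 \<Omega> x0 y2"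
    and "mixed_coderivative S1 \<Omega> x0 y1 0 \<inter> uminus ` mixed_coderivative S2 \<Omega> x0 y2 0 = {0}"
  shows "\<forall>ystar.
      mixed_coderivative (\<lambda>x. S1 x + S2 x) \<Omega> x0 y0 ystar
        \<subseteq> mixed_coderivative S1 \<Omega> x0 y1 ystar + mixed_coderivative S2 \<Omega> x0 y2 ystar \<and>
      normal_coderivative (\<lambda>x. S1 x + S2 x) \<Omega> x0 y0 ystar
        \<subseteq> normal_coderivative S1 \<Omega> x0 y1 ystar + normal_coderivative S2 \<Omega> x0 y2 ystar"
proof (intro allI conjI subsetI)
  note sequences = sum_coderivative_sequences[OF assms(2,5-9)]
  fix ystar xstar
  {
    assume "xstar \<in> mixed_coderivative (\<lambda>x. S1 x + S2 x) \<Omega> x0 y0 ystar"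
    then obtain \<epsilon> x y xs ys where rn: "rel_normal_seq (\<lambda>x. S1 x + S2 x) \<Omega> x0 y0 \<epsilon> x y xs ys"
      and xs: "weakly_converges xs xstar" and ys: "ys \<longlonglongrightarrow> ystar"
      by (auto simp: mixed_coderivative_def)
    obtain s \<epsilon>' p1 u1 xs1 l1 p2 u2 xs2 l2 where s: "strict_mono (s :: nat \<Rightarrow> nat)"
      and seqs: "rel_normal_seq S1 \<Omega> x0 y1 \<epsilon>' p1 u1 xs1 (\<lambda>k. ys (s k))" "weakly_converges xs1 l1"
        "rel_normal_seq S2 \<Omega> x0 y2 \<epsilon>' p2 u2 xs2 (\<lambda>k. ys (s k))" "weakly_converges xs2 l2"
      and sum: "xstar = l1 + l2"
      by (rule sequences[OF rn xs convergent_imp_bounded[OF ys]])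
    have "(\<lambda>k. ys (s k)) \<longlonglongrightarrow> ystar" using LIMSEQ_subseq_LIMSEQ[OF ys s] by (simp add: o_def)
    then have "l1 \<in> mixed_coderivative S1 \<Omega> x0 y1 ystar" "l2 \<in> mixed_coderivative S2 \<Omega> x0 y2 ystar"
      unfolding mixed_coderivative_def using seqs by blast+
    then show "xstar \<in> mixed_coderivative S1 \<Omega> x0 y1 ystar + mixed_coderivative S2 \<Omega> x0 y2 ystar"
      unfolding sum by (rule set_plus_intro)
  next
    assume "xstar \<in> normal_coderivative (\<lambda>x. S1 x + S2 x) \<Omega> x0 y0 ystar"
    then obtain \<epsilon> x y xs ys where rn: "rel_normal_seq (\<lambda>x. S1 x + S2 x) \<Omega> x0 y0 \<epsilon> x y xs ys"
      and xs: "weakly_converges xs xstar" and ys: "weakly_converges ys ystar"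
      by (auto simp: normal_coderivative_def)
    obtain s \<epsilon>' p1 u1 xs1 l1 p2 u2 xs2 l2 where s: "strict_mono (s :: nat \<Rightarrow> nat)"
      and seqs: "rel_normal_seq S1 \<Omega> x0 y1 \<epsilon>' p1 u1 xs1 (\<lambda>k. ys (s k))" "weakly_converges xs1 l1"
        "rel_normal_seq S2 \<Omega> x0 y2 \<epsilon>' p2 u2 xs2 (\<lambda>k. ys (s k))" "weakly_converges xs2 l2"
      and sum: "xstar = l1 + l2"
      by (rule sequences[OF rn xs weakly_converges_imp_bounded[OF ys]])
    have "weakly_converges (\<lambda>k. ys (s k)) ystar" by (rule weakly_converges_subseq[OF ys s])
    then have "l1 \<in> normal_coderivative S1 \<Omega> x0 y1 ystar" "l2 \<in> normal_coderivative S2 \<Omega> x0 y2 ystar"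
      unfolding normal_coderivative_def using seqs by blast+
    then show "xstar \<in> normal_coderivative S1 \<Omega> x0 y1 ystar + normal_coderivative S2 \<Omega> x0 y2 ystar"
      unfolding sum by (rule set_plus_intro)
  }
qed

end
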